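(* Let $\mathcal{G}=(G^0,\mathcal{G}^1,r,s)$ be an ultragraph and let $\{R_e,D_A,f_e\}_{e\in\mathcal{G}^1,A\in\mathcal{G}^0}$ be a $\mathcal{G}$-branching system on a measure space $(X,\mu)$. Suppose that $F:X\to X$ is a nonsingular map such that $F|_{R_e}=f_e^{-1}$ $\mu$-a.e. for all $e\in\mathcal{G}^1$, and let $\pi:C^*(\mathcal{G})\to B(\mathcal{L}^2(X,\mu))$ be the representation induced by the branching system, i.e. the unique representation with $\pi(s_e)(\phi)=\Phi_{f_e^{-1}}^{1/2}\cdot(\phi\circ f_e^{-1})$ (extended by zero outside $R_e$) and $\pi(p_A)(\phi)=\chi_{D_A}\phi$ for all $e\in\mathcal{G}^1,A\in\mathcal{G}^0,\phi\in\mathcal{L}^2(X,\mu)$. Let $P_F$ be the Perron-Frobenius operator of $F$. Let $\phi\in\mathcal{L}^2(X,\mu)$ and $\eta\in\mathcal{L}^1(X,\mu)$, and let $e_1,e_2,\dots$ denote pairwise distinct edges in $\mathcal{G}^1$. Then: (1) if $\mathrm{supp}(\phi)\subset\bigcup_{i=1}^n R_{e_i}$ $\mu$-a.e., then $P_F(\phi^2)=\sum_{i=1}^n(\pi(s_{e_i}^* )\phi)^2$ $\mu$-a.e.; (2) if $\mathrm{supp}(\phi)\subset\bigcup_{i=1}^\infty R_{e_i}$ $\mu$-a.e., then $P_F(\phi^2)=\lim_{n\to\infty}\sum_{i=1}^n(\pi(s_{e_i}^* )\phi)^2$ in the $\mathcal{L}^1(X,\mu)$-norm; (3) if $\eta=\eta_1-\eta_2+\mathrm{i}(\eta_3-\eta_4)$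 where each $\eta_j$ ($j=1,2,3,4$) is nonnegative $\mu$-a.e. and $\mathrm{supp}(\eta_j)\subset\bigcup_{i=1}^\infty R_{e_i}$ $\mu$-a.e., then $$P_F(\eta)=\lim_{n\to\infty}\sum_{i=1}^n\Big((\pi(s_{e_i}^* )\sqrt{\eta_1})^2-(\pi(s_{e_i}^* )\sqrt{\eta_2})^2+\mathrm{i}(\pi(s_{e_i}^* )\sqrt{\eta_3})^2-\mathrm{i}(\pi(s_{e_i}^* )\sqrt{\eta_4})^2\Big)$$ in the $\mathcal{L}^1(X,\mu)$-norm (here $\mathrm{i}$ is the imaginary unit).
   Context: Standing conventions: measure spaces are $\sigma$-finite; C*-algebras are separable; Hilbert spaces carrying representations (here $\mathcal{L}^2(X,\mu)$) are separable and infinite-dimensional; a representation is a $*$-homomorphism into $B(H)$. Ultragraph: $\mathcal{G}=(G^0,\mathcal{G}^1,r,s)$ consists of countable sets $G^0$ (vertices) and $\mathcal{G}^1$ (edges), a map $s:\mathcal{G}^1\to G^0$ and a map $r:\mathcal{G}^1\to P(G^0)\setminus\{\emptyset\}$, $P(G^0)$ being the power set. $\mathcal{G}^0$ denotes the smallest subset of $P(G^0)$ containing $\{v\}$ for all $v\in G^0$ and $r(e)$ for all $e\in\mathcal{G}^1$, and closed under finite unions and nonempty finite intersections (intersections of nonempty finite families); $\emptyset$ is regarded as an element of $\mathcal{G}^0$. A vertex $v$ is identified with $\{v\}$ in subscripts. $C^*(\mathcal{G})$ is the universal C*-algebra generated by partial isometries $\{s_e:e\in\mathcal{G}^1\}$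 with mutually orthogonal ranges and projections $\{p_A:A\in\mathcal{G}^0\}$ such that: (1) $p_\emptyset=0$, $p_Ap_B=p_{A\cap B}$, $p_{A\cup B}=p_A+p_B-p_{A\cap B}$; (2) $s_e^*s_e=p_{r(e)}$; (3) $s_es_e^*\le p_{s(e)}$; (4) $p_v=\sum_{s(e)=v}s_es_e^*$ whenever $0<|s^{-1}(v)|<\infty$. $\mathcal{G}$-branching system on $(X,\mu)$: measurable subsets $\{R_e,D_A\}_{e\in\mathcal{G}^1,A\in\mathcal{G}^0}$ of $X$ with, up to $\mu$-null sets: (1) $R_e\cap R_f=\emptyset$ if $e\ne f$; (2) $D_\emptyset=\emptyset$ (exactly), $D_A\cap D_B=D_{A\cap B}$, $D_A\cup D_B=D_{A\cup B}$; (3) $R_e\subseteq D_{s(e)}$; (4) $D_v=\bigcup_{e\in s^{-1}(v)}R_e$ if $0<|s^{-1}(v)|<\infty$; and (5) for each $e$, measurable maps $f_e:D_{r(e)}\to R_e$ and $f_e^{-1}:R_e\to D_{r(e)}$ with $f_e\circ f_e^{-1}=\mathrm{id}_{R_e}$ and $f_e^{-1}\circ f_e=\mathrm{id}_{D_{r(e)}}$ $\mu$-a.e., such that the pushforward measure $\mu\circ f_e$ on $D_{r(e)}$ (pushforward of $\mu|_{R_e}$ under $f_e^{-1}$) is absolutely continuous with respect to $\mu$ on $D_{r(e)}$, and the pushforward measure $\mu\circ f_e^{-1}$ on $R_e$ (pushforward of $\mu|_{D_{r(e)}}$ under $f_e$) is absolutely continuous with respect to $\mu$ on $R_e$. Write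 $\Phi_{f_e}=d(\mu\circ f_e)/d\mu$ and $\Phi_{f_e^{-1}}=d(\mu\circ f_e^{-1})/d\mu$ for the Radon-Nikodym derivatives. A measurable map $F:X\to X$ is nonsingular if $\mu(S)=0$ implies $\mu(F^{-1}(S))=0$ for every measurable $S\subset X$. Its Perron-Frobenius operator is the unique $P_F\in B(\mathcal{L}^1(X,\mu))$ with $\int_S P_F\psi\,\mathrm{d}\mu=\int_{F^{-1}(S)}\psi\,\mathrm{d}\mu$ for all $\psi\in\mathcal{L}^1(X,\mu)$ and all measurable $S\subset X$. "$\mathrm{supp}(\phi)\subset S$ $\mu$-a.e." means that $\phi$ vanishes $\mu$-a.e. outside $S$. *)

theory Defs
  imports "HOL-Analysis.Analysis" "HOL-Algebra.Module"
begin

section \<open>Ultragraphs\<close>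

record ('v, 'e) ultragraph =
  verts :: "'v set"
  edges :: "'e set"
  rng :: "'e \<Rightarrow> 'v set"
  src :: "'e \<Rightarrow> 'v"

locale ultragraph =
  fixes G :: "('v, 'e) ultragraph"
  assumes countable_verts: "countable (verts G)"
    and countable_edges: "countable (edges G)"
    and src_in: "e \<in> edges G \<Longrightarrow> src G e \<in> verts G"
    and rng_subset: "e \<in> edges G \<Longrightarrow> rng G e \<subseteq> verts G"
    and rng_nonempty: "e \<in> edges G \<Longrightarrow> rng G e \<noteq> {}"

text \<open>The generalized vertices. Closure under binary unions and intersections gives closure
  under finite unions and under intersections of nonempty finite families.\<close>

inductive_set gen_verts :: "('v, 'e) ultragraph \<Rightarrow> 'v set set" for G where
  empty: "{} \<in> gen_verts G"
| vertex: "v \<in> verts G \<Longrightarrow> {v} \<in> gen_verts G"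
| range: "e \<in> edges G \<Longrightarrow> rng G e \<in> gen_verts G"
| union: "A \<in> gen_verts G \<Longrightarrow> B \<in> gen_verts G \<Longrightarrow> A \<union> B \<in> gen_verts G"
| inter: "A \<in> gen_verts G \<Longrightarrow> B \<in> gen_verts G \<Longrightarrow> A \<inter> B \<in> gen_verts G"

definition out_edges :: "('v, 'e) ultragraph \<Rightarrow> 'v \<Rightarrow> 'e set" where
  "out_edges G v = {e \<in> edges G. src G e = v}"


section \<open>C*-algebras\<close>

text \<open>C*-algebras with explicit carrier, so that one can quantify over all of them on a fixed
  type. They need not have a unit: the field \<^const>\<open>one\<close> inherited from the ring record is
  left unconstrained.\<close>

record 'a cstar = "(complex, 'a) module" +
  star :: "'a \<Rightarrow> 'a"
  cnorm :: "'a \<Rightarrow> real"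

locale cstar_algebra = abelian_group A
  for A :: "('a, 'z) cstar_scheme" (structure) +
  assumes smult_closed: "x \<in> carrier A \<Longrightarrow> c \<odot> x \<in> carrier A"
    and smult_one: "x \<in> carrier A \<Longrightarrow> 1 \<odot> x = x"
    and smult_smult: "x \<in> carrier A \<Longrightarrow> c \<odot> (d \<odot> x) = (c * d) \<odot> x"
    and smult_l_distr: "x \<in> carrier A \<Longrightarrow> (c + d) \<odot> x = c \<odot> x \<oplus> d \<odot> x"
    and smult_r_distr: "\<lbrakk>x \<in> carrier A; y \<in> carrier A\<rbrakk> \<Longrightarrow> c \<odot> (x \<oplus> y) = c \<odot> x \<oplus> c \<odot> y"
    and mult_closed: "\<lbrakk>x \<in> carrier A; y \<in> carrier A\<rbrakk> \<Longrightarrow> x \<otimes> y \<in> carrier A"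
    and mult_assoc: "\<lbrakk>x \<in> carrier A; y \<in> carrier A; z \<in> carrier A\<rbrakk>
      \<Longrightarrow> (x \<otimes> y) \<otimes> z = x \<otimes> (y \<otimes> z)"
    and mult_l_distr: "\<lbrakk>x \<in> carrier A; y \<in> carrier A; z \<in> carrier A\<rbrakk>
      \<Longrightarrow> (x \<oplus> y) \<otimes> z = x \<otimes> z \<oplus> y \<otimes> z"
    and mult_r_distr: "\<lbrakk>x \<in> carrier A; y \<in> carrier A; z \<in> carrier A\<rbrakk>
      \<Longrightarrow> z \<otimes> (x \<oplus> y) = z \<otimes> x \<oplus> z \<otimes> y"
    and smult_mult_l: "\<lbrakk>x \<in> carrier A; y \<in> carrier A\<rbrakk> \<Longrightarrow> (c \<odot> x) \<otimes> y = c \<odot> (x \<otimes> y)"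
    and smult_mult_r: "\<lbrakk>x \<in> carrier A; y \<in> carrier A\<rbrakk> \<Longrightarrow> x \<otimes> (c \<odot> y) = c \<odot> (x \<otimes> y)"
    and star_closed: "x \<in> carrier A \<Longrightarrow> star A x \<in> carrier A"
    and star_star: "x \<in> carrier A \<Longrightarrow> star A (star A x) = x"
    and star_add: "\<lbrakk>x \<in> carrier A; y \<in> carrier A\<rbrakk> \<Longrightarrow> star A (x \<oplus> y) = star A x \<oplus> star A y"
    and star_smult: "x \<in> carrier A \<Longrightarrow> star A (c \<odot> x) = cnj c \<odot> star A x"
    and star_mult: "\<lbrakk>x \<in> carrier A; y \<in> carrier A\<rbrakk> \<Longrightarrow> star A (x \<otimes> y) = star A y \<otimes> star A x"
    and cnorm_nonneg: "x \<in> carrier A \<Longrightarrow> 0 \<le> cnorm A x"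
    and cnorm_eq_0: "x \<in> carrier A \<Longrightarrow> cnorm A x = 0 \<longleftrightarrow> x = \<zero>"
    and cnorm_triangle: "\<lbrakk>x \<in> carrier A; y \<in> carrier A\<rbrakk>
      \<Longrightarrow> cnorm A (x \<oplus> y) \<le> cnorm A x + cnorm A y"
    and cnorm_smult: "x \<in> carrier A \<Longrightarrow> cnorm A (c \<odot> x) = cmod c * cnorm A x"
    and cnorm_mult: "\<lbrakk>x \<in> carrier A; y \<in> carrier A\<rbrakk>
      \<Longrightarrow> cnorm A (x \<otimes> y) \<le> cnorm A x * cnorm A y"
    and cstar_identity: "x \<in> carrier A \<Longrightarrow> cnorm A (star A x \<otimes> x) = (cnorm A x)\<^sup>2"
    and complete: "\<lbrakk>range u \<subseteq> carrier A;
        \<forall>\<epsilon>>0. \<exists>N. \<forall>m\<ge>N. \<forall>n\<ge>N. cnorm A (u m \<ominus> u n) < \<epsilon>\<rbrakk>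
      \<Longrightarrow> \<exists>x\<in>carrier A. (\<lambda>n::nat. cnorm A (u n \<ominus> x)) \<longlonglongrightarrow> 0"

definition star_hom :: "('a, 'z) cstar_scheme \<Rightarrow> ('b, 'w) cstar_scheme \<Rightarrow> ('a \<Rightarrow> 'b) \<Rightarrow> bool" where
  "star_hom A B h \<longleftrightarrow>
     (\<forall>x\<in>carrier A. h x \<in> carrier B) \<and>
     (\<forall>x\<in>carrier A. \<forall>y\<in>carrier A. h (x \<oplus>\<^bsub>A\<^esub> y) = h x \<oplus>\<^bsub>B\<^esub> h y) \<and>
     (\<forall>c. \<forall>x\<in>carrier A. h (c \<odot>\<^bsub>A\<^esub> x) = c \<odot>\<^bsub>B\<^esub> h x) \<and>
     (\<forall>x\<in>carrier A. \<forall>y\<in>carrier A. h (x \<otimes>\<^bsub>A\<^esub> y) = h x \<otimes>\<^bsub>B\<^esub> h y) \<and>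
     (\<forall>x\<in>carrier A. h (star A x) = star B (h x))"

text \<open>The order \<open>x \<le> y\<close> on self-adjoint elements: \<open>y - x\<close> is positive.\<close>

definition cstar_le :: "('a, 'z) cstar_scheme \<Rightarrow> 'a \<Rightarrow> 'a \<Rightarrow> bool" where
  "cstar_le A x y \<longleftrightarrow> (\<exists>z\<in>carrier A. y \<ominus>\<^bsub>A\<^esub> x = star A z \<otimes>\<^bsub>A\<^esub> z)"

definition projection :: "('a, 'z) cstar_scheme \<Rightarrow> 'a \<Rightarrow> bool" where
  "projection A q \<longleftrightarrow> q \<in> carrier A \<and> star A q = q \<and> q \<otimes>\<^bsub>A\<^esub> q = q"

definition partial_isometry :: "('a, 'z) cstar_scheme \<Rightarrow> 'a \<Rightarrow> bool" where
  "partial_isometry A t \<longleftrightarrow> t \<in> carrier A \<and> t \<otimes>\<^bsub>A\<^esub> star A t \<otimes>\<^bsub>A\<^esub> t = t"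

definition generates :: "('a, 'z) cstar_scheme \<Rightarrow> 'a set \<Rightarrow> bool" where
  "generates A S \<longleftrightarrow> S \<subseteq> carrier A \<and>
     (\<forall>B. S \<subseteq> B \<and> B \<subseteq> carrier A \<and> \<zero>\<^bsub>A\<^esub> \<in> B \<and>
        (\<forall>x\<in>B. \<forall>y\<in>B. x \<oplus>\<^bsub>A\<^esub> y \<in> B \<and> x \<otimes>\<^bsub>A\<^esub> y \<in> B) \<and>
        (\<forall>c. \<forall>x\<in>B. c \<odot>\<^bsub>A\<^esub> x \<in> B) \<and>
        (\<forall>x\<in>B. star A x \<in> B) \<and>
        (\<forall>u. \<forall>x\<in>carrier A. range u \<subseteq> B \<and> (\<lambda>n::nat. cnorm A (u n \<ominus>\<^bsub>A\<^esub> x)) \<longlonglongrightarrow> 0 \<longrightarrow> x \<in> B)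
      \<longrightarrow> B = carrier A)"


section \<open>The C*-algebra of an ultragraph\<close>

definition cuntz_krieger_family ::
  "('v, 'e) ultragraph \<Rightarrow> ('a, 'z) cstar_scheme \<Rightarrow> ('e \<Rightarrow> 'a) \<Rightarrow> ('v set \<Rightarrow> 'a) \<Rightarrow> bool" where
  "cuntz_krieger_family G A s p \<longleftrightarrow>
     (\<forall>e\<in>edges G. partial_isometry A (s e)) \<and>
     (\<forall>e\<in>edges G. \<forall>f\<in>edges G. e \<noteq> f \<longrightarrow>
        (s e \<otimes>\<^bsub>A\<^esub> star A (s e)) \<otimes>\<^bsub>A\<^esub> (s f \<otimes>\<^bsub>A\<^esub> star A (s f)) = \<zero>\<^bsub>A\<^esub>) \<and>
     (\<forall>U\<in>gen_verts G. projection A (p U)) \<and>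
     p {} = \<zero>\<^bsub>A\<^esub> \<and>
     (\<forall>U\<in>gen_verts G. \<forall>V\<in>gen_verts G. p U \<otimes>\<^bsub>A\<^esub> p V = p (U \<inter> V)) \<and>
     (\<forall>U\<in>gen_verts G. \<forall>V\<in>gen_verts G. p (U \<union> V) = (p U \<oplus>\<^bsub>A\<^esub> p V) \<ominus>\<^bsub>A\<^esub> p (U \<inter> V)) \<and>
     (\<forall>e\<in>edges G. star A (s e) \<otimes>\<^bsub>A\<^esub> s e = p (rng G e)) \<and>
     (\<forall>e\<in>edges G. cstar_le A (s e \<otimes>\<^bsub>A\<^esub> star A (s e)) (p {src G e})) \<and>
     (\<forall>v\<in>verts G. finite (out_edges G v) \<and> out_edges G v \<noteq> {} \<longrightarrow>
        p {v} = finsum A (\<lambda>e. s e \<otimes>\<^bsub>A\<^esub> star A (s e)) (out_edges G v))"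

text \<open>The universal property is tested against C*-algebras whose carrier is a subset of
  \<^typ>\<open>real\<close>. Up to isomorphism this covers every C*-algebra generated by such a family: there
  are countably many generators, so the algebra is separable and has at most the cardinality of
  the continuum. The homomorphism is unique because the family generates.\<close>

definition universal_cstar_algebra ::
  "('v, 'e) ultragraph \<Rightarrow> ('a, 'z) cstar_scheme \<Rightarrow> ('e \<Rightarrow> 'a) \<Rightarrow> ('v set \<Rightarrow> 'a) \<Rightarrow> bool" where
  "universal_cstar_algebra G A s p \<longleftrightarrow>
     cstar_algebra A \<and>
     cuntz_krieger_family G A s p \<and>
     generates A (s ` edges G \<union> p ` gen_verts G) \<and>
     (\<forall>(B :: real cstar) t q. cstar_algebra B \<and> cuntz_krieger_family G B t q \<longrightarrow>
        (\<exists>h. star_hom A B h \<and> (\<forall>e\<in>edges G. h (s e) = t e) \<and> (\<forall>U\<in>gen_verts G. h (p U) = q U)))"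


section \<open>Lebesgue spaces and their bounded operators\<close>

text \<open>Elements of the Lebesgue spaces are represented by functions; two functions represent the
  same element iff they agree almost everywhere. An operator is a map on representatives that is
  compatible with almost everywhere equality, and equalities of operators are to be read
  almost everywhere as well.\<close>

definition L1 :: "'x measure \<Rightarrow> ('x \<Rightarrow> complex) set" where
  "L1 M = {\<psi>. integrable M \<psi>}"

definition L2 :: "'x measure \<Rightarrow> ('x \<Rightarrow> complex) set" where
  "L2 M = {\<phi> \<in> borel_measurable M. integrable M (\<lambda>x. (cmod (\<phi> x))\<^sup>2)}"

definition L1_norm :: "'x measure \<Rightarrow> ('x \<Rightarrow> complex) \<Rightarrow> real" where
  "L1_norm M \<psi> = (LINT x|M. cmod (\<psi> x))"

definition L2_norm :: "'x measure \<Rightarrow> ('x \<Rightarrow> complex) \<Rightarrow> real" where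
  "L2_norm M \<phi> = sqrt (LINT x|M. (cmod (\<phi> x))\<^sup>2)"

definition L2_inner :: "'x measure \<Rightarrow> ('x \<Rightarrow> complex) \<Rightarrow> ('x \<Rightarrow> complex) \<Rightarrow> complex" where
  "L2_inner M \<phi> \<psi> = (LINT x|M. \<phi> x * cnj (\<psi> x))"

text \<open>Membership is required because the Bochner integral of a non-integrable function is 0.\<close>

definition L1_tendsto :: "'x measure \<Rightarrow> (nat \<Rightarrow> 'x \<Rightarrow> complex) \<Rightarrow> ('x \<Rightarrow> complex) \<Rightarrow> bool" where
  "L1_tendsto M \<psi> \<xi> \<longleftrightarrow> (\<forall>n. \<psi> n \<in> L1 M) \<and> \<xi> \<in> L1 M \<and>
     (\<lambda>n. L1_norm M (\<lambda>x. \<psi> n x - \<xi> x)) \<longlonglongrightarrow> 0"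

definition L2_separable :: "'x measure \<Rightarrow> bool" where
  "L2_separable M \<longleftrightarrow> (\<exists>C. countable C \<and> C \<subseteq> L2 M \<and>
     (\<forall>\<phi>\<in>L2 M. \<forall>\<epsilon>>0. \<exists>\<psi>\<in>C. L2_norm M (\<lambda>x. \<phi> x - \<psi> x) < \<epsilon>))"

definition L2_infinite_dimensional :: "'x measure \<Rightarrow> bool" where
  "L2_infinite_dimensional M \<longleftrightarrow> \<not> (\<exists>C. finite C \<and> C \<subseteq> L2 M \<and>
     (\<forall>\<phi>\<in>L2 M. \<exists>c. AE x in M. \<phi> x = (\<Sum>\<psi>\<in>C. c \<psi> * \<psi> x)))"

definition bounded_operator ::
  "'x measure \<Rightarrow> ('x \<Rightarrow> complex) set \<Rightarrow> (('x \<Rightarrow> complex) \<Rightarrow> real)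
    \<Rightarrow> (('x \<Rightarrow> complex) \<Rightarrow> ('x \<Rightarrow> complex)) \<Rightarrow> bool" where
  "bounded_operator M V N T \<longleftrightarrow>
     (\<forall>\<phi>\<in>V. T \<phi> \<in> V) \<and>
     (\<forall>\<phi>\<in>V. \<forall>\<psi>\<in>V. (AE x in M. \<phi> x = \<psi> x) \<longrightarrow> (AE x in M. T \<phi> x = T \<psi> x)) \<and>
     (\<forall>\<phi>\<in>V. \<forall>\<psi>\<in>V. AE x in M. T (\<lambda>y. \<phi> y + \<psi> y) x = T \<phi> x + T \<psi> x) \<and>
     (\<forall>c. \<forall>\<phi>\<in>V. AE x in M. T (\<lambda>y. c * \<phi> y) x = c * T \<phi> x) \<and>
     (\<exists>K. \<forall>\<phi>\<in>V. N (T \<phi>) \<le> K * N \<phi>)"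

text \<open>*-homomorphisms from \<open>A\<close> to the bounded operators on L2; the last clause says that
  \<open>\<pi> (star A a)\<close> is the adjoint of \<open>\<pi> a\<close>.\<close>

definition L2_representation ::
  "('a, 'z) cstar_scheme \<Rightarrow> 'x measure \<Rightarrow> ('a \<Rightarrow> ('x \<Rightarrow> complex) \<Rightarrow> ('x \<Rightarrow> complex)) \<Rightarrow> bool" where
  "L2_representation A M \<pi> \<longleftrightarrow>
     (\<forall>a\<in>carrier A. bounded_operator M (L2 M) (L2_norm M) (\<pi> a)) \<and>
     (\<forall>a\<in>carrier A. \<forall>b\<in>carrier A. \<forall>\<phi>\<in>L2 M. AE x in M. \<pi> (a \<oplus>\<^bsub>A\<^esub> b) \<phi> x = \<pi> a \<phi> x + \<pi> b \<phi> x) \<and>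
     (\<forall>c. \<forall>a\<in>carrier A. \<forall>\<phi>\<in>L2 M. AE x in M. \<pi> (c \<odot>\<^bsub>A\<^esub> a) \<phi> x = c * \<pi> a \<phi> x) \<and>
     (\<forall>a\<in>carrier A. \<forall>b\<in>carrier A. \<forall>\<phi>\<in>L2 M. AE x in M. \<pi> (a \<otimes>\<^bsub>A\<^esub> b) \<phi> x = \<pi> a (\<pi> b \<phi>) x) \<and>
     (\<forall>a\<in>carrier A. \<forall>\<phi>\<in>L2 M. \<forall>\<psi>\<in>L2 M. L2_inner M (\<pi> a \<phi>) \<psi> = L2_inner M \<phi> (\<pi> (star A a) \<psi>))"


section \<open>Branching systems\<close>

definition AE_eq :: "'x measure \<Rightarrow> 'x set \<Rightarrow> 'x set \<Rightarrow> bool" where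
  "AE_eq M S T \<longleftrightarrow> (AE x in M. x \<in> S \<longleftrightarrow> x \<in> T)"

definition AE_subset :: "'x measure \<Rightarrow> 'x set \<Rightarrow> 'x set \<Rightarrow> bool" where
  "AE_subset M S T \<longleftrightarrow> (AE x in M. x \<in> S \<longrightarrow> x \<in> T)"

definition supported_in :: "'x measure \<Rightarrow> ('x \<Rightarrow> 'b::zero) \<Rightarrow> 'x set \<Rightarrow> bool" where
  "supported_in M \<phi> S \<longleftrightarrow> (AE x in M. x \<notin> S \<longrightarrow> \<phi> x = 0)"

text \<open>The image under \<open>h : S \<rightarrow> T\<close> of the restriction of \<open>M\<close> to \<open>S\<close>, as a measure on \<open>T\<close>.\<close>

definition pushforward :: "'x measure \<Rightarrow> 'x set \<Rightarrow> 'x set \<Rightarrow> ('x \<Rightarrow> 'x) \<Rightarrow> 'x measure" where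
  "pushforward M S T h = distr (restrict_space M S) (restrict_space M T) h"

text \<open>\<open>g e\<close> is the (almost everywhere) inverse of \<open>f e\<close>.\<close>

locale branching_system = ultragraph G + sigma_finite_measure M
  for G :: "('v, 'e) ultragraph" and M :: "'x measure" +
  fixes R :: "'e \<Rightarrow> 'x set" and D :: "'v set \<Rightarrow> 'x set" and f g :: "'e \<Rightarrow> 'x \<Rightarrow> 'x"
  assumes R_sets: "e \<in> edges G \<Longrightarrow> R e \<in> sets M"
    and D_sets: "U \<in> gen_verts G \<Longrightarrow> D U \<in> sets M"
    and R_disjoint: "\<lbrakk>e \<in> edges G; e' \<in> edges G; e \<noteq> e'\<rbrakk> \<Longrightarrow> AE_eq M (R e \<inter> R e') {}"
    and D_empty: "D {} = {}"
    and D_inter: "\<lbrakk>U \<in> gen_verts G; V \<in> gen_verts G\<rbrakk> \<Longrightarrow> AE_eq M (D U \<inter> D V) (D (U \<inter> V))"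
    and D_union: "\<lbrakk>U \<in> gen_verts G; V \<in> gen_verts G\<rbrakk> \<Longrightarrow> AE_eq M (D U \<union> D V) (D (U \<union> V))"
    and R_subset: "e \<in> edges G \<Longrightarrow> AE_subset M (R e) (D {src G e})"
    and D_vertex: "\<lbrakk>v \<in> verts G; finite (out_edges G v); out_edges G v \<noteq> {}\<rbrakk>
      \<Longrightarrow> AE_eq M (D {v}) (\<Union>e\<in>out_edges G v. R e)"
    and f_measurable: "e \<in> edges G \<Longrightarrow>
      f e \<in> measurable (restrict_space M (D (rng G e))) (restrict_space M (R e))"
    and g_measurable: "e \<in> edges G \<Longrightarrow>
      g e \<in> measurable (restrict_space M (R e)) (restrict_space M (D (rng G e)))"
    and f_g: "e \<in> edges G \<Longrightarrow> AE x in M. x \<in> R e \<longrightarrow> f e (g e x) = x"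
    and g_f: "e \<in> edges G \<Longrightarrow> AE x in M. x \<in> D (rng G e) \<longrightarrow> g e (f e x) = x"
    and f_abs_cont: "e \<in> edges G \<Longrightarrow>
      absolutely_continuous (restrict_space M (D (rng G e)))
        (pushforward M (R e) (D (rng G e)) (g e))"
    and g_abs_cont: "e \<in> edges G \<Longrightarrow>
      absolutely_continuous (restrict_space M (R e))
        (pushforward M (D (rng G e)) (R e) (f e))"

text \<open>The Radon-Nikodym derivative of \<open>\<mu> \<circ> f\<^sub>e\<^sup>-\<^sup>1\<close> (the image of \<open>\<mu>\<close> under \<open>f\<^sub>e\<close>)
  with respect to \<open>\<mu>\<close> on \<open>R\<^sub>e\<close>; it is finite almost everywhere.\<close>

definition Phi_inv ::
  "('v, 'e) ultragraph \<Rightarrow> 'x measure \<Rightarrow> ('e \<Rightarrow> 'x set) \<Rightarrow> ('v set \<Rightarrow> 'x set) \<Rightarrow> ('e \<Rightarrow> 'x \<Rightarrow> 'x)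
    \<Rightarrow> 'e \<Rightarrow> 'x \<Rightarrow> real" where
  "Phi_inv G M R D f e x =
     enn2real (RN_deriv (restrict_space M (R e)) (pushforward M (D (rng G e)) (R e) (f e)) x)"

definition induced_representation ::
  "('v, 'e) ultragraph \<Rightarrow> ('a, 'z) cstar_scheme \<Rightarrow> ('e \<Rightarrow> 'a) \<Rightarrow> ('v set \<Rightarrow> 'a)
    \<Rightarrow> 'x measure \<Rightarrow> ('e \<Rightarrow> 'x set) \<Rightarrow> ('v set \<Rightarrow> 'x set) \<Rightarrow> ('e \<Rightarrow> 'x \<Rightarrow> 'x) \<Rightarrow> ('e \<Rightarrow> 'x \<Rightarrow> 'x)
    \<Rightarrow> ('a \<Rightarrow> ('x \<Rightarrow> complex) \<Rightarrow> ('x \<Rightarrow> complex)) \<Rightarrow> bool" where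
  "induced_representation G A s p M R D f g \<pi> \<longleftrightarrow>
     L2_representation A M \<pi> \<and>
     (\<forall>e\<in>edges G. \<forall>\<phi>\<in>L2 M. AE x in M. \<pi> (s e) \<phi> x =
        (if x \<in> R e then complex_of_real (sqrt (Phi_inv G M R D f e x)) * \<phi> (g e x) else 0)) \<and>
     (\<forall>U\<in>gen_verts G. \<forall>\<phi>\<in>L2 M. AE x in M. \<pi> (p U) \<phi> x = indicator (D U) x * \<phi> x)"


section \<open>Perron-Frobenius operators\<close>

definition nonsingular :: "'x measure \<Rightarrow> ('x \<Rightarrow> 'x) \<Rightarrow> bool" where
  "nonsingular M F \<longleftrightarrow> F \<in> measurable M M \<and>
     (\<forall>S\<in>sets M. emeasure M S = 0 \<longrightarrow> emeasure M (F -` S \<inter> space M) = 0)"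

definition perron_frobenius ::
  "'x measure \<Rightarrow> ('x \<Rightarrow> 'x) \<Rightarrow> (('x \<Rightarrow> complex) \<Rightarrow> ('x \<Rightarrow> complex)) \<Rightarrow> bool" where
  "perron_frobenius M F P \<longleftrightarrow>
     bounded_operator M (L1 M) (L1_norm M) P \<and>
     (\<forall>\<psi>\<in>L1 M. \<forall>S\<in>sets M. (LINT x:S|M. P \<psi> x) = (LINT x:(F -` S \<inter> space M)|M. \<psi> x))"

end

theory Submission
  imports Defs
begin

text \<open>Every edge \<open>e\<close> gives a nonsingular isomorphism \<open>f e : D (rng G e) \<rightarrow> R e\<close>. On functions
  supported in \<open>R e\<close> both operators are explicit: \<open>\<pi> (star A (s e)) \<phi> = \<Phi>\<^sup>-\<^sup>1\<^sup>/\<^sup>2 \<phi> \<circ> f e\<close>, by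
  uniqueness of adjoints, and \<open>P \<zeta> = \<Phi>\<^sup>-\<^sup>1 \<zeta> \<circ> f e\<close>, by the change of variables formula,
  where \<open>\<Phi>\<close> is the Radon-Nikodym derivative of the image measure under \<open>f e\<close>, evaluated at
  \<open>f e\<close>. Hence \<open>P (\<chi> \<phi>\<^sup>2)\<close> is the square of \<open>\<pi> (star A (s e)) \<phi>\<close> for the indicator \<open>\<chi>\<close> of
  \<open>R e\<close>. Finite sums are handled by disjointness of the \<open>R e\<close>, infinite ones by dominated
  convergence and continuity of \<open>P\<close>, and the complex case by linearity.\<close>

section \<open>Change of variables along a nonsingular isomorphism\<close>

text \<open>Isolates the measure theory of a single edge: \<open>X\<close> and \<open>Y\<close>
  stand for the restrictions of the measure to \<open>D (rng G e)\<close> and \<open>R e\<close>.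
  The assumption \<open>ac_f\<close> yields the density of the image measure on \<open>Y\<close>,
  and \<open>ac_g\<close> makes that density positive.\<close>

locale nonsingular_isomorphism =
  X: sigma_finite_measure X + Y: sigma_finite_measure Y
  for X :: "'a measure" and Y :: "'b measure" +
  fixes f :: "'a \<Rightarrow> 'b" and g :: "'b \<Rightarrow> 'a"
  assumes f_meas [measurable]: "f \<in> measurable X Y"
    and g_meas [measurable]: "g \<in> measurable Y X"
    and f_g: "AE y in Y. f (g y) = y"
    and g_f: "AE x in X. g (f x) = x"
    and ac_g: "absolutely_continuous X (distr Y X g)"
    and ac_f: "absolutely_continuous Y (distr X Y f)"
begin

text \<open>The derivative is made real-valued so that it can act as a scalar on functions with
  values in any Banach space. For an edge it becomes \<open>Phi_inv\<close>.\<close>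

definition jac :: "'b \<Rightarrow> real" where
  "jac y = enn2real (RN_deriv Y (distr X Y f) y)"

lemma jac_measurable [measurable]: "jac \<in> borel_measurable Y"
  unfolding jac_def by measurable

lemma jac_nonneg: "0 \<le> jac y"
  by (simp add: jac_def)

text \<open>If sets \<open>C i\<close> of finite measure exhaust \<open>X\<close>, their preimages
  under \<open>g\<close> exhaust \<open>Y\<close>. Pulling these back along \<open>f\<close> returns
  \<open>C i\<close> up to a null set, because \<open>g\<close> inverts \<open>f\<close> almost
  everywhere, so their image measure is finite.\<close>

lemma sigma_finite_distr: "sigma_finite_measure (distr X Y f)"
proof -
  obtain C :: "nat \<Rightarrow> 'a set" where C: "range C \<subseteq> sets X" "(\<Union>i. C i) = space X"
      "\<And>i. emeasure X (C i) \<noteq> \<infinity>"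
    using X.sigma_finite by metis
  have C_sets [measurable]: "C i \<in> sets X" for i
    using C(1) by auto
  define B where "B i = g -` C i \<inter> space Y" for i
  have B_sets [measurable]: "B i \<in> sets Y" for i
    unfolding B_def by measurable
  have "emeasure (distr X Y f) (B i) = emeasure X (C i)" for i
  proof -
    have "emeasure (distr X Y f) (B i) = emeasure X (f -` B i \<inter> space X)"
      by (rule emeasure_distr) auto
    also have "\<dots> = emeasure X (C i)"
    proof (rule emeasure_eq_AE)
      show "AE x in X. x \<in> f -` B i \<inter> space X \<longleftrightarrow> x \<in> C i"
        using g_f AE_space
      proof eventually_elim
        case (elim x)
        then show ?case
          using measurable_space[OF f_meas, of x] by (auto simp: B_def)
      qed
    qed (auto intro: measurable_sets[OF f_meas])
    finally show ?thesis .
  qed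
  then have "emeasure (distr X Y f) (B i) \<noteq> \<infinity>" for i
    using C(3) by simp
  moreover have "(\<Union>i. B i) = space Y"
    using C(2) measurable_space[OF g_meas] unfolding B_def by fastforce
  ultimately show ?thesis
    by (intro sigma_finite_measure.intro exI[of _ "range B"]) (auto intro: B_sets)
qed

text \<open>The image measure is sigma-finite, so its derivative is finite almost everywhere and the
  truncation by \<open>enn2real\<close> in \<open>jac\<close> loses nothing.\<close>

lemma density_jac: "density Y (\<lambda>y. ennreal (jac y)) = distr X Y f"
proof -
  have "AE y in Y. RN_deriv Y (distr X Y f) y \<noteq> \<infinity>"
    by (rule Y.RN_deriv_finite[OF sigma_finite_distr ac_f]) simp
  then have "AE y in Y. ennreal (jac y) = RN_deriv Y (distr X Y f) y"
    by eventually_elim (simp add: jac_def less_top)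
  then have "density Y (\<lambda>y. ennreal (jac y)) = density Y (RN_deriv Y (distr X Y f))"
    by (intro density_cong) auto
  also have "\<dots> = distr X Y f"
    by (rule Y.density_RN_deriv[OF ac_f]) simp
  finally show ?thesis .
qed

text \<open>The zero set \<open>Z\<close> of the density has image measure 0, so its preimage under
  \<open>f\<close> is null in \<open>X\<close>. By \<open>ac_g\<close>, pulling that back along
  \<open>g\<close> gives a null set in \<open>Y\<close>; since \<open>f (g y) = y\<close> almost
  everywhere, this set is \<open>Z\<close> again up to a null set.\<close>

lemma jac_pos: "AE y in Y. 0 < jac y"
proof -
  define Z where "Z = {y \<in> space Y. jac y = 0}"
  have Z [measurable]: "Z \<in> sets Y"
    unfolding Z_def by measurable
  have "emeasure (distr X Y f) Z = (\<integral>\<^sup>+ y. ennreal (jac y) * indicator Z y \<partial>Y)"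
    unfolding density_jac[symmetric] by (rule emeasure_density) auto
  also have "\<dots> = (\<integral>\<^sup>+ y. 0 \<partial>Y)"
    by (intro nn_integral_cong) (auto simp: Z_def split: split_indicator)
  finally have "emeasure X (f -` Z \<inter> space X) = 0"
    by (simp add: emeasure_distr)
  then have "emeasure (distr Y X g) (f -` Z \<inter> space X) = 0"
    by (rule absolutely_continuousD[OF ac_g measurable_sets[OF f_meas Z]])
  then have "emeasure Y (g -` (f -` Z \<inter> space X) \<inter> space Y) = 0"
    by (simp add: emeasure_distr measurable_sets[OF f_meas Z])
  then have "AE y in Y. y \<notin> g -` (f -` Z \<inter> space X) \<inter> space Y"
    by (intro AE_not_in) (auto intro!: null_setsI measurable_sets[OF f_meas] measurable_sets[OF g_meas])
  then show ?thesis
    using f_g AE_space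
  proof eventually_elim
    case (elim y)
    then have "y \<notin> Z"
      using measurable_space[OF g_meas, of y] by auto
    then show ?case
      using elim(3) jac_nonneg[of y] by (auto simp: Z_def)
  qed
qed

text \<open>Integrating a function of \<open>f x\<close> over \<open>X\<close> means integrating it
  over \<open>Y\<close> with weight \<open>jac\<close>; the weight cancels the division because it
  is positive almost everywhere.\<close>

lemma integrable_transfer:
  fixes \<zeta> :: "'b \<Rightarrow> 'c::{banach, second_countable_topology}"
  assumes "integrable Y \<zeta>"
  shows "integrable X (\<lambda>x. \<zeta> (f x) /\<^sub>R jac (f x))"
proof -
  have [measurable]: "\<zeta> \<in> borel_measurable Y"
    using assms by auto
  have "integrable Y (\<lambda>y. jac y *\<^sub>R (\<zeta> y /\<^sub>R jac y))"
    by (rule integrable_cong_AE_imp[OF assms]) (use jac_pos in auto)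
  then have "integrable (density Y (\<lambda>y. ennreal (jac y))) (\<lambda>y. \<zeta> y /\<^sub>R jac y)"
    by (subst integrable_density) (auto simp: jac_nonneg)
  then show ?thesis
    unfolding density_jac by (subst (asm) integrable_distr_eq) auto
qed

lemma integral_transfer:
  fixes \<zeta> :: "'b \<Rightarrow> 'c::{banach, second_countable_topology}"
  assumes [measurable]: "\<zeta> \<in> borel_measurable Y" "S \<in> sets X"
  shows "(LINT x|X. indicator S x *\<^sub>R (\<zeta> (f x) /\<^sub>R jac (f x)))
       = (LINT y|Y. indicator S (g y) *\<^sub>R \<zeta> y)"
proof -
  let ?h = "\<lambda>y. indicator S (g y) *\<^sub>R (\<zeta> y /\<^sub>R jac y)"
  \<comment> \<open>Almost everywhere \<open>x = g (f x)\<close>, so the indicator becomes a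
    function of \<open>f x\<close> and the whole integrand factors through \<open>f\<close>.\<close>
  have "(LINT x|X. indicator S x *\<^sub>R (\<zeta> (f x) /\<^sub>R jac (f x))) = (LINT x|X. ?h (f x))"
    by (rule integral_cong_AE) (use g_f in auto)
  also have "\<dots> = integral\<^sup>L (distr X Y f) ?h"
    by (rule integral_distr[symmetric]) auto
  also have "\<dots> = (LINT y|Y. jac y *\<^sub>R ?h y)"
    unfolding density_jac[symmetric] by (subst integral_density) (auto simp: jac_nonneg)
  also have "\<dots> = (LINT y|Y. indicator S (g y) *\<^sub>R \<zeta> y)"
    by (rule integral_cong_AE) (use jac_pos in auto)
  finally show ?thesis .
qed

end

section \<open>Operators on Lebesgue spaces\<close>

lemma L1_measurable: "\<psi> \<in> L1 M \<Longrightarrow> \<psi> \<in> borel_measurable M"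
  by (auto simp: L1_def)

lemma L2_measurable: "\<phi> \<in> L2 M \<Longrightarrow> \<phi> \<in> borel_measurable M"
  by (simp add: L2_def)

lemma L1_add: "\<phi> \<in> L1 M \<Longrightarrow> \<psi> \<in> L1 M \<Longrightarrow> (\<lambda>x. \<phi> x + \<psi> x) \<in> L1 M"
  by (simp add: L1_def)

lemma L1_cmult: "\<phi> \<in> L1 M \<Longrightarrow> (\<lambda>x. c * \<phi> x) \<in> L1 M"
  by (simp add: L1_def)

lemma L1_indicator: "\<phi> \<in> L1 M \<Longrightarrow> S \<in> sets M \<Longrightarrow> (\<lambda>x. indicator S x *\<^sub>R \<phi> x) \<in> L1 M"
  unfolding L1_def using integrable_mult_indicator[of S M \<phi>] by simp

lemma L1_cong_AE:
  "\<phi> \<in> L1 M \<Longrightarrow> \<psi> \<in> borel_measurable M \<Longrightarrow> AE x in M. \<phi> x = \<psi> x \<Longrightarrow> \<psi> \<in> L1 M"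
  unfolding L1_def mem_Collect_eq by (rule integrable_cong_AE_imp)

lemma L2_power2: "\<phi> \<in> L2 M \<Longrightarrow> (\<lambda>x. (\<phi> x)\<^sup>2) \<in> L1 M"
  unfolding L1_def L2_def mem_Collect_eq
  by (rule Bochner_Integration.integrable_bound) (auto simp: norm_power)

lemma L2_mult_integrable:
  assumes "\<phi> \<in> L2 M" "\<psi> \<in> L2 M"
  shows "integrable M (\<lambda>x. \<phi> x * \<psi> x)"
proof (rule Bochner_Integration.integrable_bound)
  show "integrable M (\<lambda>x. (cmod (\<phi> x))\<^sup>2 + (cmod (\<psi> x))\<^sup>2)"
    using assms by (simp add: L2_def)
  have "cmod a * cmod b \<le> (cmod a)\<^sup>2 + (cmod b)\<^sup>2" for a b
    using sum_squares_bound[of "cmod a" "cmod b"] mult_nonneg_nonneg[OF norm_ge_zero norm_ge_zero, of a b]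
    unfolding mult.assoc by linarith
  then show "AE x in M. norm (\<phi> x * \<psi> x) \<le> norm ((cmod (\<phi> x))\<^sup>2 + (cmod (\<psi> x))\<^sup>2)"
    by (simp add: norm_mult)
qed (use assms in \<open>auto simp: L2_def\<close>)

lemma borel_measurable_cnj [measurable]: "cnj \<in> borel_measurable borel"
  by (intro borel_measurable_continuous_onI continuous_intros)

lemma L2_cnj: "\<phi> \<in> L2 M \<Longrightarrow> (\<lambda>x. cnj (\<phi> x)) \<in> L2 M"
  by (auto simp: L2_def)

lemma L2_diff:
  assumes "\<phi> \<in> L2 M" "\<psi> \<in> L2 M"
  shows "(\<lambda>x. \<phi> x - \<psi> x) \<in> L2 M"
proof -
  have "integrable M (\<lambda>x. (cmod (\<phi> x - \<psi> x))\<^sup>2)"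
  proof (rule Bochner_Integration.integrable_bound)
    show "integrable M (\<lambda>x. 2 * (cmod (\<phi> x))\<^sup>2 + 2 * (cmod (\<psi> x))\<^sup>2)"
      using assms by (simp add: L2_def)
    have "(cmod (a - b))\<^sup>2 \<le> 2 * (cmod a)\<^sup>2 + 2 * (cmod b)\<^sup>2" for a b
    proof -
      have "(cmod (a - b))\<^sup>2 \<le> (cmod a + cmod b)\<^sup>2"
        by (intro power_mono norm_triangle_ineq4) simp
      then show ?thesis
        using sum_squares_bound[of "cmod a" "cmod b"] by (simp add: power2_sum)
    qed
    then show "AE x in M. norm ((cmod (\<phi> x - \<psi> x))\<^sup>2)
        \<le> norm (2 * (cmod (\<phi> x))\<^sup>2 + 2 * (cmod (\<psi> x))\<^sup>2)"
      by simp
  qed (use assms in \<open>auto simp: L2_def\<close>)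
  then show ?thesis
    using assms by (auto simp: L2_def)
qed

lemma L2_inner_cong_AE:
  assumes [measurable]: "\<phi> \<in> borel_measurable M" "\<phi>' \<in> borel_measurable M"
      "\<psi> \<in> borel_measurable M" "\<psi>' \<in> borel_measurable M"
    and "AE x in M. \<phi> x * cnj (\<psi> x) = \<phi>' x * cnj (\<psi>' x)"
  shows "L2_inner M \<phi> \<psi> = L2_inner M \<phi>' \<psi>'"
  unfolding L2_inner_def using assms(5) by (intro integral_cong_AE) auto

text \<open>The difference of the two functions is itself a legitimate test function, and testing
  with it forces its L2 norm to vanish. This turns an identity of inner products into a formula for
  an adjoint.\<close>

lemma L2_eq_AE_if_inner_eq:
  assumes \<phi>: "\<phi> \<in> L2 M" and \<psi>: "\<psi> \<in> L2 M"
    and inner: "\<And>\<xi>. \<xi> \<in> L2 M \<Longrightarrow> L2_inner M \<xi> \<phi> = L2_inner M \<xi> \<psi>"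
  shows "AE x in M. \<phi> x = \<psi> x"
proof -
  define \<delta> where "\<delta> x = \<phi> x - \<psi> x" for x
  have \<delta>: "\<delta> \<in> L2 M"
    unfolding \<delta>_def by (rule L2_diff[OF \<phi> \<psi>])
  have "complex_of_real (LINT x|M. (cmod (\<delta> x))\<^sup>2) = (LINT x|M. \<delta> x * cnj (\<delta> x))"
    unfolding integral_complex_of_real[symmetric] complex_norm_square ..
  also have "\<dots> = (LINT x|M. \<delta> x * cnj (\<phi> x) - \<delta> x * cnj (\<psi> x))"
    by (simp add: \<delta>_def algebra_simps)
  also have "\<dots> = L2_inner M \<delta> \<phi> - L2_inner M \<delta> \<psi>"
    unfolding L2_inner_def
    by (intro Bochner_Integration.integral_diff L2_mult_integrable L2_cnj \<delta> \<phi> \<psi>)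
  also have "\<dots> = 0"
    using inner[OF \<delta>] by simp
  finally have "(LINT x|M. (cmod (\<delta> x))\<^sup>2) = 0"
    by simp
  then have "AE x in M. (cmod (\<delta> x))\<^sup>2 = 0"
    using \<delta> by (subst (asm) integral_nonneg_eq_0_iff_AE) (auto simp: L2_def)
  then show ?thesis
    by (simp add: \<delta>_def)
qed

section \<open>Linearity of bounded operators up to null sets\<close>

lemma bounded_operator_L1_closed:
  "bounded_operator M (L1 M) (L1_norm M) P \<Longrightarrow> \<phi> \<in> L1 M \<Longrightarrow> P \<phi> \<in> L1 M"
  by (simp add: bounded_operator_def)

lemma bounded_operator_cong:
  "bounded_operator M V N T \<Longrightarrow> \<phi> \<in> V \<Longrightarrow> \<psi> \<in> V \<Longrightarrow> AE x in M. \<phi> x = \<psi> x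
    \<Longrightarrow> AE x in M. T \<phi> x = T \<psi> x"
  by (simp add: bounded_operator_def)

lemma bounded_operator_add:
  "bounded_operator M V N T \<Longrightarrow> \<phi> \<in> V \<Longrightarrow> \<psi> \<in> V
    \<Longrightarrow> AE x in M. T (\<lambda>y. \<phi> y + \<psi> y) x = T \<phi> x + T \<psi> x"
  by (simp add: bounded_operator_def)

lemma bounded_operator_cmult:
  "bounded_operator M V N T \<Longrightarrow> \<phi> \<in> V \<Longrightarrow> AE x in M. T (\<lambda>y. c * \<phi> y) x = c * T \<phi> x"
  by (simp add: bounded_operator_def)

lemma bounded_operator_L1_sum:
  assumes P: "bounded_operator M (L1 M) (L1_norm M) P"
    and "finite I" and "\<And>i. i \<in> I \<Longrightarrow> \<phi> i \<in> L1 M"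
  shows "AE x in M. P (\<lambda>y. \<Sum>i\<in>I. \<phi> i y) x = (\<Sum>i\<in>I. P (\<phi> i) x)"
  using assms(2,3)
proof (induction I)
  case empty
  have "(\<lambda>y. 0) \<in> L1 M"
    by (simp add: L1_def)
  then show ?case
    \<comment> \<open>The zero function is 0 times itself, so homogeneity with scalar 0 settles the
      empty sum.\<close>
    using bounded_operator_cmult[OF P, of "\<lambda>y. 0" 0] by simp
next
  case (insert i I)
  have "(\<lambda>y. \<Sum>i\<in>I. \<phi> i y) \<in> L1 M"
    using insert.prems by (auto simp: L1_def)
  then have "AE x in M. P (\<lambda>y. \<phi> i y + (\<Sum>i\<in>I. \<phi> i y)) x = P (\<phi> i) x + P (\<lambda>y. \<Sum>i\<in>I. \<phi> i y) x"
    using insert.prems by (intro bounded_operator_add[OF P]) auto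
  moreover have "AE x in M. P (\<lambda>y. \<Sum>i\<in>I. \<phi> i y) x = (\<Sum>i\<in>I. P (\<phi> i) x)"
    using insert by auto
  ultimately show ?case
    by eventually_elim (simp add: insert.hyps)
qed

section \<open>Convergence in the L1 norm\<close>

lemma L1_norm_tendsto_0:
  assumes "\<And>n. L1_norm M (\<psi> n) \<le> b n" "b \<longlonglongrightarrow> 0"
  shows "(\<lambda>n::nat. L1_norm M (\<psi> n)) \<longlonglongrightarrow> 0"
  by (rule tendsto_sandwich[OF _ _ tendsto_const assms(2)]) (simp_all add: assms(1), simp add: L1_norm_def)

lemma L1_tendsto_add:
  assumes "L1_tendsto M \<phi> \<xi>" "L1_tendsto M \<psi> \<zeta>"
  shows "L1_tendsto M (\<lambda>n x. \<phi> n x + \<psi> n x) (\<lambda>x. \<xi> x + \<zeta> x)"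
proof -
  have int: "integrable M (\<phi> n)" "integrable M (\<psi> n)" "integrable M \<xi>" "integrable M \<zeta>" for n
    using assms by (auto simp: L1_tendsto_def L1_def)
  have lim: "(\<lambda>n. L1_norm M (\<lambda>x. \<phi> n x - \<xi> x) + L1_norm M (\<lambda>x. \<psi> n x - \<zeta> x)) \<longlonglongrightarrow> 0"
    using assms by (intro tendsto_add_zero) (simp_all add: L1_tendsto_def)
  have "L1_norm M (\<lambda>x. \<phi> n x + \<psi> n x - (\<xi> x + \<zeta> x))
      \<le> L1_norm M (\<lambda>x. \<phi> n x - \<xi> x) + L1_norm M (\<lambda>x. \<psi> n x - \<zeta> x)" for n
  proof -
    have "L1_norm M (\<lambda>x. \<phi> n x + \<psi> n x - (\<xi> x + \<zeta> x))
        \<le> (LINT x|M. cmod (\<phi> n x - \<xi> x) + cmod (\<psi> n x - \<zeta> x))"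
      unfolding L1_norm_def add_diff_add
      by (intro integral_mono norm_triangle_ineq Bochner_Integration.integrable_add
          Bochner_Integration.integrable_diff integrable_norm int)
    also have "\<dots> = L1_norm M (\<lambda>x. \<phi> n x - \<xi> x) + L1_norm M (\<lambda>x. \<psi> n x - \<zeta> x)"
      unfolding L1_norm_def
      by (intro Bochner_Integration.integral_add Bochner_Integration.integrable_diff
          integrable_norm int)
    finally show ?thesis .
  qed
  then have "(\<lambda>n. L1_norm M (\<lambda>x. \<phi> n x + \<psi> n x - (\<xi> x + \<zeta> x))) \<longlonglongrightarrow> 0"
    by (rule L1_norm_tendsto_0[OF _ lim])
  then show ?thesis
    using int by (auto simp: L1_tendsto_def L1_def)
qed

lemma L1_tendsto_cmult:
  assumes "L1_tendsto M \<phi> \<xi>"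
  shows "L1_tendsto M (\<lambda>n x. c * \<phi> n x) (\<lambda>x. c * \<xi> x)"
proof -
  have "(\<lambda>n. cmod c * L1_norm M (\<lambda>x. \<phi> n x - \<xi> x)) \<longlonglongrightarrow> cmod c * 0"
    using assms by (intro tendsto_mult_left) (simp add: L1_tendsto_def)
  moreover have "L1_norm M (\<lambda>x. c * \<phi> n x - c * \<xi> x) = cmod c * L1_norm M (\<lambda>x. \<phi> n x - \<xi> x)" for n
    by (simp add: L1_norm_def right_diff_distrib[symmetric] norm_mult)
  ultimately show ?thesis
    using assms by (auto simp: L1_tendsto_def L1_def)
qed

text \<open>Over an incomplete measure, almost everywhere equality with a measurable function does
  not give measurability, hence the assumptions \<open>meas\<close> on the new
  representatives.\<close>

lemma L1_tendsto_cong_AE: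
  assumes lim: "L1_tendsto M \<phi> \<xi>"
    and meas: "\<And>n. \<psi> n \<in> borel_measurable M" "\<zeta> \<in> borel_measurable M"
    and eq: "\<And>n. AE x in M. \<phi> n x = \<psi> n x" "AE x in M. \<xi> x = \<zeta> x"
  shows "L1_tendsto M \<psi> \<zeta>"
proof -
  have L1: "\<phi> n \<in> L1 M" "\<xi> \<in> L1 M" for n
    using lim by (auto simp: L1_tendsto_def)
  have "L1_norm M (\<lambda>x. \<phi> n x - \<xi> x) = L1_norm M (\<lambda>x. \<psi> n x - \<zeta> x)" for n
    unfolding L1_norm_def
  proof (rule integral_cong_AE)
    show "AE x in M. cmod (\<phi> n x - \<xi> x) = cmod (\<psi> n x - \<zeta> x)"
      using eq(1)[of n] eq(2) by eventually_elim simp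
  qed (use meas L1[THEN L1_measurable] in auto)
  then show ?thesis
    using lim L1_cong_AE[OF L1(1) meas(1) eq(1)] L1_cong_AE[OF L1(2) meas(2) eq(2)]
    by (simp add: L1_tendsto_def)
qed

lemma bounded_operator_L1_tendsto:
  assumes P: "bounded_operator M (L1 M) (L1_norm M) P" and lim: "L1_tendsto M \<phi> \<xi>"
  shows "L1_tendsto M (\<lambda>n. P (\<phi> n)) (P \<xi>)"
proof -
  have L1: "\<phi> n \<in> L1 M" "\<xi> \<in> L1 M" for n
    using lim by (auto simp: L1_tendsto_def)
  then have P_L1: "P (\<phi> n) \<in> L1 M" "P \<xi> \<in> L1 M" for n
    using bounded_operator_L1_closed[OF P] by auto
  \<comment> \<open>The difference is written as a sum with a multiple by -1, since boundedness of
    an operator is formulated with sums and scalar multiples.\<close>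
  have diff_L1: "(\<lambda>y. \<phi> n y + (- 1) * \<xi> y) \<in> L1 M" for n
    by (intro L1_add L1_cmult L1)
  obtain K where K: "L1_norm M (P \<psi>) \<le> K * L1_norm M \<psi>" if "\<psi> \<in> L1 M" for \<psi>
    using P unfolding bounded_operator_def by blast
  have "L1_norm M (\<lambda>x. P (\<phi> n) x - P \<xi> x) \<le> K * L1_norm M (\<lambda>x. \<phi> n x - \<xi> x)" for n
  proof -
    have "AE x in M. P (\<lambda>y. \<phi> n y + (- 1) * \<xi> y) x = P (\<phi> n) x - P \<xi> x"
      using bounded_operator_add[OF P L1(1) L1_cmult[OF L1(2)], of n "- 1"]
        bounded_operator_cmult[OF P L1(2), of "- 1"]
      by eventually_elim simp
    then have "L1_norm M (\<lambda>x. P (\<phi> n) x - P \<xi> x) = L1_norm M (P (\<lambda>y. \<phi> n y + (- 1) * \<xi> y))"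
      unfolding L1_norm_def
      using P_L1[THEN L1_measurable] bounded_operator_L1_closed[OF P diff_L1, THEN L1_measurable]
      by (intro integral_cong_AE) auto
    also have "\<dots> \<le> K * L1_norm M (\<lambda>y. \<phi> n y + (- 1) * \<xi> y)"
      by (rule K[OF diff_L1])
    finally show ?thesis
      by simp
  qed
  moreover have "(\<lambda>n. K * L1_norm M (\<lambda>x. \<phi> n x - \<xi> x)) \<longlonglongrightarrow> K * 0"
    using lim by (intro tendsto_mult_left) (simp add: L1_tendsto_def)
  ultimately have "(\<lambda>n. L1_norm M (\<lambda>x. P (\<phi> n) x - P \<xi> x)) \<longlonglongrightarrow> 0"
    by (intro L1_norm_tendsto_0[where b = "\<lambda>n. K * L1_norm M (\<lambda>x. \<phi> n x - \<xi> x)"]) simp_all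
  then show ?thesis
    using P_L1 by (simp add: L1_tendsto_def)
qed

text \<open>Dominated convergence: a point of the union lies in \<open>S m\<close> for some
  \<open>m\<close> and is untouched by the cut-off from index \<open>m\<close> on; at almost every
  other point \<zeta> vanishes. The error is bounded by the modulus of \<zeta> throughout.\<close>

lemma L1_tendsto_indicator_UN:
  assumes \<zeta>: "\<zeta> \<in> L1 M" and S: "\<And>i. i \<in> {1..} \<Longrightarrow> S i \<in> sets M"
    and supp: "supported_in M \<zeta> (\<Union>i\<in>{1::nat..}. S i)"
  shows "L1_tendsto M (\<lambda>n x. indicator (\<Union>i\<in>{1..n}. S i) x *\<^sub>R \<zeta> x) \<zeta>"
proof -
  let ?U = "\<lambda>n. \<Union>i\<in>{1..n}. S i"
  have U: "?U n \<in> sets M" for n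
    using S by auto
  have L1: "(\<lambda>x. indicator (?U n) x *\<^sub>R \<zeta> x) \<in> L1 M" for n
    by (rule L1_indicator[OF \<zeta> U])
  have "(\<lambda>n. LINT x|M. cmod (indicator (?U n) x *\<^sub>R \<zeta> x - \<zeta> x)) \<longlonglongrightarrow> (LINT x|M. 0)"
  proof (rule integral_dominated_convergence)
    show "integrable M (\<lambda>x. cmod (\<zeta> x))"
      using \<zeta> by (simp add: L1_def)
    show "AE x in M. (\<lambda>n. cmod (indicator (?U n) x *\<^sub>R \<zeta> x - \<zeta> x)) \<longlonglongrightarrow> 0"
      using supp unfolding supported_in_def
    proof eventually_elim
      case (elim x)
      show ?case
      proof (cases "x \<in> (\<Union>i\<in>{1..}. S i)")
        case True
        then obtain m where m: "1 \<le> m" "x \<in> S m"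
          by auto
        have "eventually (\<lambda>n. cmod (indicator (?U n) x *\<^sub>R \<zeta> x - \<zeta> x) = 0) sequentially"
          using eventually_ge_at_top[of m]
        proof eventually_elim
          case (elim n)
          then have "x \<in> ?U n"
            using m by auto
          then show ?case
            by simp
        qed
        then show ?thesis
          by (rule tendsto_eventually)
      next
        case False
        then show ?thesis
          using elim by simp
      qed
    qed
    show "AE x in M. norm (cmod (indicator (?U n) x *\<^sub>R \<zeta> x - \<zeta> x)) \<le> cmod (\<zeta> x)" for n
      by (auto split: split_indicator)
  qed (use L1_measurable[OF \<zeta>] L1_measurable[OF L1] in auto)
  then show ?thesis
    using \<zeta> L1 by (simp add: L1_tendsto_def L1_norm_def)
qed

text \<open>The edge maps live on restricted spaces, while the L2 norm and \<open>P\<close> refer to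
  all of \<open>M\<close>; these equivalences pass between the two by extending functions by
  zero.\<close>

lemma
  fixes h :: "'a \<Rightarrow> 'b::{banach, second_countable_topology}"
  assumes "S \<in> sets M"
  shows borel_measurable_restrict_space_indicator:
      "h \<in> borel_measurable (restrict_space M S)
        \<longleftrightarrow> (\<lambda>x. indicator S x *\<^sub>R h x) \<in> borel_measurable M"
    and integrable_restrict_space_indicator:
      "integrable (restrict_space M S) h \<longleftrightarrow> integrable M (\<lambda>x. indicator S x *\<^sub>R h x)"
    and integral_restrict_space_indicator:
      "integral\<^sup>L (restrict_space M S) h = (LINT x|M. indicator S x *\<^sub>R h x)"
  using assms
  by (simp_all add: borel_measurable_restrict_space_iff integrable_restrict_space
      integral_restrict_space)

section \<open>The induced representation and the Perron-Frobenius operator\<close>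

context branching_system
begin

lemma D_rng_sets: "e \<in> edges G \<Longrightarrow> D (rng G e) \<in> sets M"
  by (intro D_sets gen_verts.range)

lemma nonsingular_isomorphism_edge:
  assumes "e \<in> edges G"
  shows "nonsingular_isomorphism (restrict_space M (D (rng G e))) (restrict_space M (R e)) (f e) (g e)"
proof -
  have sf: "sigma_finite_measure M" ..
  show ?thesis
    using assms f_measurable g_measurable f_g g_f f_abs_cont g_abs_cont
    by (intro nonsingular_isomorphism.intro nonsingular_isomorphism_axioms.intro
        sigma_finite_measure_restrict_space[OF sf])
      (auto simp: R_sets D_rng_sets AE_restrict_space_iff pushforward_def)
qed

lemma Phi_inv_eq_jac:
  assumes "e \<in> edges G"
  shows "Phi_inv G M R D f e
    = nonsingular_isomorphism.jac (restrict_space M (D (rng G e))) (restrict_space M (R e)) (f e)"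
  unfolding Phi_inv_def[abs_def] pushforward_def
    nonsingular_isomorphism.jac_def[OF nonsingular_isomorphism_edge[OF assms], abs_def] ..

lemma Phi_inv_nonneg: "0 \<le> Phi_inv G M R D f e x"
  by (simp add: Phi_inv_def)

lemma Phi_inv_measurable:
  "e \<in> edges G \<Longrightarrow> Phi_inv G M R D f e \<in> borel_measurable (restrict_space M (R e))"
  by (simp add: Phi_inv_eq_jac
      nonsingular_isomorphism.jac_measurable[OF nonsingular_isomorphism_edge])

lemma Phi_inv_pos:
  assumes "e \<in> edges G"
  shows "AE x in M. x \<in> R e \<longrightarrow> 0 < Phi_inv G M R D f e x"
  using nonsingular_isomorphism.jac_pos[OF nonsingular_isomorphism_edge[OF assms]]
  by (simp add: Phi_inv_eq_jac[OF assms] AE_restrict_space_iff R_sets assms)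

section \<open>The Perron-Frobenius operator on a single edge\<close>

text \<open>The factor, the inverse of \<open>Phi_inv\<close> at \<open>f e x\<close>, is almost
  everywhere the other Radon-Nikodym derivative, that of \<mu> \<circ> f_e. The codomain is
  polymorphic because both complex functions and the real function
  \<open>(cmod (\<phi> y))\<^sup>2\<close> are transferred.\<close>

definition transfer :: "'e \<Rightarrow> ('x \<Rightarrow> 'c) \<Rightarrow> 'x \<Rightarrow> 'c::{banach, second_countable_topology}" where
  "transfer e \<zeta> x = indicator (D (rng G e)) x *\<^sub>R (\<zeta> (f e x) /\<^sub>R Phi_inv G M R D f e (f e x))"

lemma integrable_transfer:
  assumes e: "e \<in> edges G" and \<zeta>: "integrable M \<zeta>"
  shows "integrable M (transfer e \<zeta>)"
proof -
  interpret E: nonsingular_isomorphism "restrict_space M (D (rng G e))" "restrict_space M (R e)" "f e" "g e"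
    by (rule nonsingular_isomorphism_edge[OF e])
  have "integrable (restrict_space M (R e)) \<zeta>"
    unfolding integrable_restrict_space_indicator[OF R_sets[OF e]]
    by (rule integrable_mult_indicator[OF R_sets[OF e] \<zeta>])
  from E.integrable_transfer[OF this] show ?thesis
    unfolding integrable_restrict_space_indicator[OF D_rng_sets[OF e]]
    by (simp add: transfer_def[abs_def] Phi_inv_eq_jac[OF e])
qed

text \<open>Two integrable functions with equal integrals over every measurable \<open>S\<close>
  agree almost everywhere. For \<open>transfer e \<zeta>\<close> the change of variables moves the
  integral over \<open>S\<close> to \<open>R e\<close>, where the preimages of \<open>S\<close>
  under \<open>F\<close> and under \<open>g e\<close> agree up to a null set; the result is the
  integral that characterizes \<open>P\<close>.\<close>

lemma perron_frobenius_edge: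
  assumes e: "e \<in> edges G"
    and F: "F \<in> measurable M M" "AE x in M. x \<in> R e \<longrightarrow> F x = g e x"
    and P: "perron_frobenius M F P" and \<zeta>: "\<zeta> \<in> L1 M"
  shows "AE x in M. P (\<lambda>x. indicator (R e) x *\<^sub>R \<zeta> x) x = transfer e \<zeta> x"
proof -
  interpret E: nonsingular_isomorphism "restrict_space M (D (rng G e))" "restrict_space M (R e)" "f e" "g e"
    by (rule nonsingular_isomorphism_edge[OF e])
  let ?D = "D (rng G e)"
  let ?\<zeta> = "\<lambda>x. indicator (R e) x *\<^sub>R \<zeta> x"
  have [measurable]: "R e \<in> sets M" "?D \<in> sets M" "\<zeta> \<in> borel_measurable M" "F \<in> measurable M M"
    using e F \<zeta> by (auto simp: R_sets D_rng_sets L1_measurable)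
  have \<zeta>_L1: "?\<zeta> \<in> L1 M"
    by (rule L1_indicator[OF \<zeta>]) simp
  have P_L1: "P ?\<zeta> \<in> L1 M"
    using P \<zeta>_L1 by (auto simp: perron_frobenius_def bounded_operator_def)
  show ?thesis
  proof (rule density_unique_banach)
    show "integrable M (P ?\<zeta>)"
      using P_L1 by (simp add: L1_def)
    show "integrable M (transfer e \<zeta>)"
      using integrable_transfer[OF e] \<zeta> by (simp add: L1_def)
    fix S assume S [measurable]: "S \<in> sets M"
    \<comment> \<open>The change of variables needs a set that is measurable in the restricted
      space, so \<open>S\<close> is replaced by its trace.\<close>
    have S_D: "S \<inter> ?D \<in> sets (restrict_space M ?D)"
      by (auto simp: sets_restrict_space)
    have "(LINT x:S|M. transfer e \<zeta> x) = (LINT x|M. indicator ?D x *\<^sub>R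
        (indicator (S \<inter> ?D) x *\<^sub>R (\<zeta> (f e x) /\<^sub>R E.jac (f e x))))"
      unfolding set_lebesgue_integral_def transfer_def Phi_inv_eq_jac[OF e]
      by (intro Bochner_Integration.integral_cong) (auto split: split_indicator)
    also have "\<dots> = (LINT x|restrict_space M ?D.
        indicator (S \<inter> ?D) x *\<^sub>R (\<zeta> (f e x) /\<^sub>R E.jac (f e x)))"
      by (rule integral_restrict_space_indicator[symmetric]) simp
    also have "\<dots> = (LINT x|restrict_space M (R e). indicator (S \<inter> ?D) (g e x) *\<^sub>R \<zeta> x)"
      by (rule E.integral_transfer) (auto intro: S_D measurable_restrict_space1)
    \<comment> \<open>On \<open>R e\<close> the point \<open>g e x\<close> always lies in
      \<open>D (rng G e)\<close>, so membership in the trace is membership in \<open>S\<close>;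
      moreover \<open>g e x = F x\<close> almost everywhere.\<close>
    also have "\<dots> = (LINT x|restrict_space M (R e). indicator (F -` S \<inter> space M) x *\<^sub>R \<zeta> x)"
    proof (rule integral_cong_AE)
      show "AE x in restrict_space M (R e). indicator (S \<inter> ?D) (g e x) *\<^sub>R \<zeta> x
          = indicator (F -` S \<inter> space M) x *\<^sub>R \<zeta> x"
      proof (subst AE_restrict_space_iff)
        show "R e \<inter> space M \<in> sets M"
          by simp
        show "AE x in M. x \<in> R e \<longrightarrow> indicator (S \<inter> ?D) (g e x) *\<^sub>R \<zeta> x
            = indicator (F -` S \<inter> space M) x *\<^sub>R \<zeta> x"
          using F(2) AE_space
        proof eventually_elim
          case (elim x)
          then show ?case
            using measurable_space[OF g_measurable[OF e], of x]
            by (auto simp: space_restrict_space split: split_indicator)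
        qed
      qed
      show "(\<lambda>x. indicator (S \<inter> ?D) (g e x) *\<^sub>R \<zeta> x) \<in> borel_measurable (restrict_space M (R e))"
        using S_D by (intro borel_measurable_scaleR borel_measurable_indicator'
            measurable_compose[OF E.g_meas borel_measurable_indicator] measurable_restrict_space1) auto
      show "(\<lambda>x. indicator (F -` S \<inter> space M) x *\<^sub>R \<zeta> x) \<in> borel_measurable (restrict_space M (R e))"
        by (intro measurable_restrict_space1) measurable
    qed
    also have "\<dots> = (LINT x|M. indicator (R e) x *\<^sub>R (indicator (F -` S \<inter> space M) x *\<^sub>R \<zeta> x))"
      by (rule integral_restrict_space_indicator) simp
    also have "\<dots> = (LINT x:(F -` S \<inter> space M)|M. ?\<zeta> x)"
      unfolding set_lebesgue_integral_def by (simp add: mult.commute)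
    also have "\<dots> = (LINT x:S|M. P ?\<zeta> x)"
      using P \<zeta>_L1 S by (simp add: perron_frobenius_def)
    finally show "(LINT x:S|M. P ?\<zeta> x) = (LINT x:S|M. transfer e \<zeta> x)" ..
  qed
qed

section \<open>The adjoint of a generator\<close>

definition pullback :: "'e \<Rightarrow> ('x \<Rightarrow> complex) \<Rightarrow> 'x \<Rightarrow> complex" where
  "pullback e \<phi> x =
     indicator (D (rng G e)) x *\<^sub>R (\<phi> (f e x) /\<^sub>R sqrt (Phi_inv G M R D f e (f e x)))"

text \<open>The link between the two operators: squaring turns the weight of the adjoint into the
  weight of the Perron-Frobenius operator. The equality holds at every point, since a zero of
  \<open>Phi_inv\<close> has inverse 0 on both sides.\<close>

lemma pullback_power2: "(pullback e \<phi> x)\<^sup>2 = transfer e (\<lambda>y. (\<phi> y)\<^sup>2) x"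
  by (simp add: pullback_def transfer_def scaleR_power power_inverse Phi_inv_nonneg
      split: split_indicator)

lemma pullback_measurable:
  assumes e: "e \<in> edges G" and \<phi>: "\<phi> \<in> borel_measurable M"
  shows "pullback e \<phi> \<in> borel_measurable M"
proof -
  have [measurable]: "Phi_inv G M R D f e \<in> borel_measurable (restrict_space M (R e))"
      "\<phi> \<in> borel_measurable (restrict_space M (R e))"
      "f e \<in> measurable (restrict_space M (D (rng G e))) (restrict_space M (R e))"
    using Phi_inv_measurable[OF e] measurable_restrict_space1[OF \<phi>] f_measurable[OF e] by auto
  have "(\<lambda>x. \<phi> (f e x) /\<^sub>R sqrt (Phi_inv G M R D f e (f e x)))
      \<in> borel_measurable (restrict_space M (D (rng G e)))"
    by measurable
  then show ?thesis
    unfolding borel_measurable_restrict_space_indicator[OF D_rng_sets[OF e]] pullback_def[abs_def] .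
qed

text \<open>The squared modulus of the pullback is the transfer of the squared modulus, which is
  integrable.\<close>

lemma pullback_L2:
  assumes e: "e \<in> edges G" and \<phi>: "\<phi> \<in> L2 M"
  shows "pullback e \<phi> \<in> L2 M"
proof -
  have "(cmod (pullback e \<phi> x))\<^sup>2 = transfer e (\<lambda>y. (cmod (\<phi> y))\<^sup>2) x" for x
    by (simp add: pullback_def transfer_def power_mult_distrib power_inverse Phi_inv_nonneg
        split: split_indicator)
  moreover have "integrable M (transfer e (\<lambda>y. (cmod (\<phi> y))\<^sup>2))"
    using \<phi> by (intro integrable_transfer[OF e]) (simp add: L2_def)
  ultimately show ?thesis
    using pullback_measurable[OF e L2_measurable[OF \<phi>]] by (simp add: L2_def)
qed

text \<open>On \<open>R e\<close> the two square roots cancel, \<open>Phi_inv\<close> being positive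
  almost everywhere, and \<open>f e (g e x) = x\<close>; off \<open>R e\<close> the generator gives
  0.\<close>

lemma generator_pullback:
  assumes e: "e \<in> edges G" and \<phi>: "\<phi> \<in> L2 M"
    and ind: "induced_representation G A s p M R D f g \<pi>"
  shows "AE x in M. \<pi> (s e) (pullback e \<phi>) x = indicator (R e) x * \<phi> x"
proof -
  have "AE x in M. \<pi> (s e) (pullback e \<phi>) x = (if x \<in> R e
      then complex_of_real (sqrt (Phi_inv G M R D f e x)) * pullback e \<phi> (g e x) else 0)"
    using ind e pullback_L2[OF e \<phi>] by (simp add: induced_representation_def)
  then show ?thesis
    using f_g[OF e] Phi_inv_pos[OF e] AE_space
  proof eventually_elim
    case (elim x)
    show ?case
    proof (cases "x \<in> R e")
      case True
      \<comment> \<open>This makes the indicator inside \<open>pullback\<close> equal to 1 at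
        \<open>g e x\<close>.\<close>
      then have "g e x \<in> D (rng G e)"
        using measurable_space[OF g_measurable[OF e], of x] elim(4)
        by (simp add: space_restrict_space)
      then show ?thesis
        using True elim by (simp add: pullback_def scaleR_conv_of_real)
    qed (use elim in simp)
  qed
qed

text \<open>The generator is a partial isometry from the functions on \<open>D (rng G e)\<close> onto those on
  \<open>R e\<close>, with \<^const>\<open>pullback\<close> as a right inverse; hence its adjoint is \<^const>\<open>pullback\<close>.\<close>

lemma adjoint_generator:
  assumes e: "e \<in> edges G" and \<phi>: "\<phi> \<in> L2 M"
    and A: "cstar_algebra A" and ck: "cuntz_krieger_family G A s p"
    and ind: "induced_representation G A s p M R D f g \<pi>"
  shows "\<pi> (star A (s e)) \<phi> \<in> L2 M"
    and "AE x in M. \<pi> (star A (s e)) \<phi> x = pullback e \<phi> x"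
proof -
  let ?s = "\<pi> (s e)" and ?t = "\<pi> (star A (s e))" and ?\<psi> = "pullback e \<phi>"
  have rep: "L2_representation A M \<pi>"
    using ind by (simp add: induced_representation_def)
  have s: "s e \<in> carrier A"
    using ck e by (auto simp: cuntz_krieger_family_def partial_isometry_def)
  have t: "star A (s e) \<in> carrier A"
    by (rule cstar_algebra.star_closed[OF A s])
  have ts: "star A (s e) \<otimes>\<^bsub>A\<^esub> s e = p (rng G e)"
    using ck e by (simp add: cuntz_krieger_family_def)
  have closed: "?s \<xi> \<in> L2 M" "?t \<xi> \<in> L2 M" if "\<xi> \<in> L2 M" for \<xi>
    using rep s t that by (auto simp: L2_representation_def bounded_operator_def)
  have adj: "L2_inner M (?s \<xi>) \<zeta> = L2_inner M \<xi> (?t \<zeta>)" if "\<xi> \<in> L2 M" "\<zeta> \<in> L2 M" for \<xi> \<zeta>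
    using rep s that by (simp add: L2_representation_def)
  have \<psi>: "?\<psi> \<in> L2 M"
    by (rule pullback_L2[OF e \<phi>])
  \<comment> \<open>The relation \<open>ts\<close> makes the adjoint followed after the generator
    act as multiplication by the indicator of \<open>D (rng G e)\<close>, which fixes a pullback
    because it vanishes elsewhere.\<close>
  have "AE x in M. \<pi> (star A (s e) \<otimes>\<^bsub>A\<^esub> s e) ?\<psi> x = ?t (?s ?\<psi>) x"
    using rep s t \<psi> by (simp add: L2_representation_def)
  moreover have "AE x in M. \<pi> (p (rng G e)) ?\<psi> x = indicator (D (rng G e)) x * ?\<psi> x"
    using ind \<psi> gen_verts.range[OF e] by (simp add: induced_representation_def)
  ultimately have ts_\<psi>: "AE x in M. ?t (?s ?\<psi>) x = ?\<psi> x"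
    unfolding ts by eventually_elim (simp add: pullback_def split: split_indicator_asm)
  show t_\<phi>: "?t \<phi> \<in> L2 M"
    by (rule closed(2)[OF \<phi>])
  show "AE x in M. ?t \<phi> x = ?\<psi> x"
  proof (rule L2_eq_AE_if_inner_eq[OF t_\<phi> \<psi>])
    fix \<xi> assume \<xi>: "\<xi> \<in> L2 M"
    have s_\<xi>: "AE x in M. x \<notin> R e \<longrightarrow> ?s \<xi> x = 0"
    proof -
      have "AE x in M. ?s \<xi> x =
          (if x \<in> R e then complex_of_real (sqrt (Phi_inv G M R D f e x)) * \<xi> (g e x) else 0)"
        using ind e \<xi> by (simp add: induced_representation_def)
      then show ?thesis
        by eventually_elim simp
    qed
    have "L2_inner M \<xi> (?t \<phi>) = L2_inner M (?s \<xi>) \<phi>"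
      by (rule adj[OF \<xi> \<phi>, symmetric])
    \<comment> \<open>The left factor vanishes off \<open>R e\<close>, and on \<open>R e\<close> the
      function \<open>?s ?\<psi>\<close> agrees with \<phi> almost everywhere, so only this part of
      \<phi> contributes.\<close>
    also have "\<dots> = L2_inner M (?s \<xi>) (?s ?\<psi>)"
    proof (rule L2_inner_cong_AE)
      show "AE x in M. ?s \<xi> x * cnj (\<phi> x) = ?s \<xi> x * cnj (?s ?\<psi> x)"
        using s_\<xi> generator_pullback[OF e \<phi> ind]
        by eventually_elim (auto split: split_indicator)
    qed (intro L2_measurable closed \<xi> \<psi> \<phi>)+
    also have "\<dots> = L2_inner M \<xi> (?t (?s ?\<psi>))"
      by (rule adj[OF \<xi> closed(1)[OF \<psi>]])
    also have "\<dots> = L2_inner M \<xi> ?\<psi>"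
    proof (rule L2_inner_cong_AE)
      show "AE x in M. \<xi> x * cnj (?t (?s ?\<psi>) x) = \<xi> x * cnj (?\<psi> x)"
        using ts_\<psi> by eventually_elim simp
    qed (intro L2_measurable closed \<xi> \<psi>)+
    finally show "L2_inner M \<xi> (?t \<phi>) = L2_inner M \<xi> ?\<psi>" .
  qed
qed

section \<open>Finite and infinite families of edges\<close>

text \<open>The ranges are disjoint only up to null sets; in each induction step, finitely many
  exceptional null sets are discarded together.\<close>

lemma sum_indicator_R:
  assumes "finite I" "e ` I \<subseteq> edges G" "inj_on e I"
  shows "AE x in M. (\<Sum>i\<in>I. indicator (R (e i)) x) = (indicator (\<Union>i\<in>I. R (e i)) x :: real)"
  using assms
proof (induction I)
  case (insert j I)
  have "AE x in M. \<forall>i\<in>I. \<not> (x \<in> R (e j) \<and> x \<in> R (e i))"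
  proof (rule AE_finite_allI[OF insert.hyps(1)])
    fix i assume "i \<in> I"
    then have "AE_eq M (R (e j) \<inter> R (e i)) {}"
      using insert.prems insert.hyps(2) by (intro R_disjoint) auto
    then show "AE x in M. \<not> (x \<in> R (e j) \<and> x \<in> R (e i))"
      by (simp add: AE_eq_def)
  qed
  moreover have "AE x in M. (\<Sum>i\<in>I. indicator (R (e i)) x) = (indicator (\<Union>i\<in>I. R (e i)) x :: real)"
    using insert by auto
  ultimately show ?case
  proof eventually_elim
    case (elim x)
    then show ?case
      unfolding sum.insert[OF insert.hyps] elim(2) by (auto split: split_indicator)
  qed
qed simp

text \<open>Cutting off by the indicator replaces a support condition, so the same identity serves
  the finite case and each partial sum of an infinite family. It is the sum of the single-edge
  identities by additivity of \<open>P\<close>.\<close>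

lemma perron_frobenius_edges:
  fixes e :: "'i \<Rightarrow> 'e"
  assumes I: "finite I" "e ` I \<subseteq> edges G" "inj_on e I" and \<phi>: "\<phi> \<in> L2 M"
    and A: "cstar_algebra A" and ck: "cuntz_krieger_family G A s p"
    and ind: "induced_representation G A s p M R D f g \<pi>"
    and F: "F \<in> measurable M M" "\<forall>e\<in>edges G. AE x in M. x \<in> R e \<longrightarrow> F x = g e x"
    and P: "perron_frobenius M F P"
  shows "AE x in M. P (\<lambda>y. indicator (\<Union>i\<in>I. R (e i)) y *\<^sub>R (\<phi> y)\<^sup>2) x
      = (\<Sum>i\<in>I. (\<pi> (star A (s (e i))) \<phi> x)\<^sup>2)"
proof -
  have bP: "bounded_operator M (L1 M) (L1_norm M) P"
    using P by (simp add: perron_frobenius_def)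
  let ?\<zeta> = "\<lambda>i y. indicator (R (e i)) y *\<^sub>R (\<phi> y)\<^sup>2"
  let ?U = "\<Union>i\<in>I. R (e i)"
  have edge: "e i \<in> edges G" if "i \<in> I" for i
    using I that by auto
  have \<zeta>: "?\<zeta> i \<in> L1 M" if "i \<in> I" for i
    by (intro L1_indicator L2_power2 \<phi> R_sets edge that)
  have "AE x in M. P (?\<zeta> i) x = (\<pi> (star A (s (e i))) \<phi> x)\<^sup>2" if "i \<in> I" for i
    using perron_frobenius_edge[OF edge[OF that] F(1) F(2)[rule_format, OF edge[OF that]] P L2_power2[OF \<phi>]]
      adjoint_generator(2)[OF edge[OF that] \<phi> A ck ind]
    by eventually_elim (simp add: pullback_power2)
  then have "AE x in M. \<forall>i\<in>I. P (?\<zeta> i) x = (\<pi> (star A (s (e i))) \<phi> x)\<^sup>2"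
    by (rule AE_finite_allI[OF I(1)])
  moreover have "AE x in M. P (\<lambda>y. \<Sum>i\<in>I. ?\<zeta> i y) x = (\<Sum>i\<in>I. P (?\<zeta> i) x)"
    by (rule bounded_operator_L1_sum[OF bP I(1) \<zeta>])
  moreover have "AE x in M. P (\<lambda>y. indicator ?U y *\<^sub>R (\<phi> y)\<^sup>2) x = P (\<lambda>y. \<Sum>i\<in>I. ?\<zeta> i y) x"
  proof (rule bounded_operator_cong[OF bP])
    show "(\<lambda>y. indicator ?U y *\<^sub>R (\<phi> y)\<^sup>2) \<in> L1 M"
      using I edge by (intro L1_indicator L2_power2 \<phi> sets.finite_UN R_sets) auto
    show "(\<lambda>y. \<Sum>i\<in>I. ?\<zeta> i y) \<in> L1 M"
      using \<zeta> by (auto simp: L1_def)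
    show "AE y in M. indicator ?U y *\<^sub>R (\<phi> y)\<^sup>2 = (\<Sum>i\<in>I. ?\<zeta> i y)"
      using sum_indicator_R[OF I]
    proof eventually_elim
      case (elim y)
      show ?case
        unfolding elim[symmetric] by (rule scaleR_sum_left)
    qed
  qed
  ultimately show ?thesis
    by eventually_elim simp
qed

lemma perron_frobenius_finite:
  fixes e :: "'i \<Rightarrow> 'e"
  assumes I: "finite I" "e ` I \<subseteq> edges G" "inj_on e I" and \<phi>: "\<phi> \<in> L2 M"
    and supp: "supported_in M \<phi> (\<Union>i\<in>I. R (e i))"
    and A: "cstar_algebra A" and ck: "cuntz_krieger_family G A s p"
    and ind: "induced_representation G A s p M R D f g \<pi>"
    and F: "F \<in> measurable M M" "\<forall>e\<in>edges G. AE x in M. x \<in> R e \<longrightarrow> F x = g e x"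
    and P: "perron_frobenius M F P"
  shows "AE x in M. P (\<lambda>y. (\<phi> y)\<^sup>2) x = (\<Sum>i\<in>I. (\<pi> (star A (s (e i))) \<phi> x)\<^sup>2)"
proof -
  let ?U = "\<Union>i\<in>I. R (e i)"
  have bP: "bounded_operator M (L1 M) (L1_norm M) P"
    using P by (simp add: perron_frobenius_def)
  have "AE x in M. P (\<lambda>y. (\<phi> y)\<^sup>2) x = P (\<lambda>y. indicator ?U y *\<^sub>R (\<phi> y)\<^sup>2) x"
  proof (rule bounded_operator_cong[OF bP L2_power2[OF \<phi>]])
    show "(\<lambda>y. indicator ?U y *\<^sub>R (\<phi> y)\<^sup>2) \<in> L1 M"
      using I by (intro L1_indicator L2_power2 \<phi> sets.finite_UN R_sets) auto
    show "AE y in M. (\<phi> y)\<^sup>2 = indicator ?U y *\<^sub>R (\<phi> y)\<^sup>2"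
      using supp unfolding supported_in_def
      by eventually_elim (simp add: indicator_def del: UN_iff)
  qed
  then show ?thesis
    using perron_frobenius_edges[OF I \<phi> A ck ind F P] by eventually_elim simp
qed

text \<open>The cut-offs of \<open>(\<phi> y)\<^sup>2\<close> to finite unions converge in L1,
  continuity of \<open>P\<close> carries the convergence over, and \<open>P\<close> maps each
  cut-off to a partial sum.\<close>

lemma perron_frobenius_sequence:
  fixes e :: "nat \<Rightarrow> 'e"
  assumes e: "e ` {1..} \<subseteq> edges G" "inj_on e {1..}" and \<phi>: "\<phi> \<in> L2 M"
    and supp: "supported_in M \<phi> (\<Union>i\<in>{1..}. R (e i))"
    and A: "cstar_algebra A" and ck: "cuntz_krieger_family G A s p"
    and ind: "induced_representation G A s p M R D f g \<pi>"
    and F: "F \<in> measurable M M" "\<forall>e\<in>edges G. AE x in M. x \<in> R e \<longrightarrow> F x = g e x"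
    and P: "perron_frobenius M F P"
  shows "L1_tendsto M (\<lambda>n x. \<Sum>i=1..n. (\<pi> (star A (s (e i))) \<phi> x)\<^sup>2) (P (\<lambda>y. (\<phi> y)\<^sup>2))"
proof -
  have bP: "bounded_operator M (L1 M) (L1_norm M) P"
    using P by (simp add: perron_frobenius_def)
  have "supported_in M (\<lambda>y. (\<phi> y)\<^sup>2) (\<Union>i\<in>{1..}. R (e i))"
    using supp by (simp add: supported_in_def)
  then have "L1_tendsto M (\<lambda>n x. indicator (\<Union>i\<in>{1..n}. R (e i)) x *\<^sub>R (\<phi> x)\<^sup>2) (\<lambda>y. (\<phi> y)\<^sup>2)"
    using e by (intro L1_tendsto_indicator_UN L2_power2 \<phi> R_sets) auto
  then have lim: "L1_tendsto M
      (\<lambda>n. P (\<lambda>x. indicator (\<Union>i\<in>{1..n}. R (e i)) x *\<^sub>R (\<phi> x)\<^sup>2)) (P (\<lambda>y. (\<phi> y)\<^sup>2))"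
    by (rule bounded_operator_L1_tendsto[OF bP])
  show ?thesis
  proof (rule L1_tendsto_cong_AE[OF lim])
    fix n
    have "(\<lambda>x. (\<pi> (star A (s (e i))) \<phi> x)\<^sup>2) \<in> borel_measurable M" if "i \<in> {1..n}" for i
    proof -
      have "e i \<in> edges G"
        using e(1) that by auto
      from adjoint_generator(1)[OF this \<phi> A ck ind] show ?thesis
        by (intro L1_measurable L2_power2)
    qed
    then show "(\<lambda>x. \<Sum>i=1..n. (\<pi> (star A (s (e i))) \<phi> x)\<^sup>2) \<in> borel_measurable M"
      by (rule borel_measurable_sum)
    show "AE x in M. P (\<lambda>x. indicator (\<Union>i\<in>{1..n}. R (e i)) x *\<^sub>R (\<phi> x)\<^sup>2) x
        = (\<Sum>i=1..n. (\<pi> (star A (s (e i))) \<phi> x)\<^sup>2)"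
      by (rule perron_frobenius_edges[OF _ _ _ \<phi> A ck ind F P])
        (use e in \<open>auto intro: inj_on_subset\<close>)
  qed (use lim in \<open>auto simp: L1_tendsto_def intro: L1_measurable\<close>)
qed

end

section \<open>Square roots and complex linear combinations\<close>

text \<open>\<open>sqrt\<close> is extended to negative numbers as an odd function, so the squared
  modulus of the root is the absolute value of \<xi> at every point.\<close>

lemma L2_sqrt:
  assumes "integrable M \<xi>"
  shows "(\<lambda>y. complex_of_real (sqrt (\<xi> y))) \<in> L2 M"
proof -
  have "integrable M (\<lambda>y. \<bar>\<xi> y\<bar>)"
    using assms by (rule integrable_abs)
  also have "(\<lambda>y. \<bar>\<xi> y\<bar>) = (\<lambda>y. (cmod (complex_of_real (sqrt (\<xi> y))))\<^sup>2)"
    by (simp add: real_sqrt_power[symmetric])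
  finally show ?thesis
    using assms by (auto simp: L2_def)
qed

text \<open>Nesting to the right lets additivity peel off one summand at a time. The coefficients
  will be -1, \<i> and -\<i>, so that subtraction is expressed by scalars.\<close>

lemma bounded_operator_L1_combination:
  assumes P: "bounded_operator M (L1 M) (L1_norm M) P"
    and L1: "\<eta> \<in> L1 M" "\<zeta>\<^sub>1 \<in> L1 M" "\<zeta>\<^sub>2 \<in> L1 M" "\<zeta>\<^sub>3 \<in> L1 M" "\<zeta>\<^sub>4 \<in> L1 M"
    and \<eta>: "AE x in M. \<eta> x = \<zeta>\<^sub>1 x + (a * \<zeta>\<^sub>2 x + (b * \<zeta>\<^sub>3 x + c * \<zeta>\<^sub>4 x))"
  shows "AE x in M. P \<eta> x = P \<zeta>\<^sub>1 x + (a * P \<zeta>\<^sub>2 x + (b * P \<zeta>\<^sub>3 x + c * P \<zeta>\<^sub>4 x))"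
proof -
  have L1_4: "(\<lambda>x. b * \<zeta>\<^sub>3 x + c * \<zeta>\<^sub>4 x) \<in> L1 M"
    by (intro L1_add L1_cmult L1)
  have L1_3: "(\<lambda>x. a * \<zeta>\<^sub>2 x + (b * \<zeta>\<^sub>3 x + c * \<zeta>\<^sub>4 x)) \<in> L1 M"
    by (intro L1_add L1_cmult L1)
  show ?thesis
    using bounded_operator_cong[OF P L1(1) L1_add[OF L1(2) L1_3] \<eta>]
      bounded_operator_add[OF P L1(2) L1_3]
      bounded_operator_add[OF P L1_cmult[OF L1(3), of a] L1_4]
      bounded_operator_add[OF P L1_cmult[OF L1(4), of b] L1_cmult[OF L1(5), of c]]
      bounded_operator_cmult[OF P L1(3), of a] bounded_operator_cmult[OF P L1(4), of b]
      bounded_operator_cmult[OF P L1(5), of c]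
    by eventually_elim simp
qed

theorem theorem5p5:
  fixes G :: "('v, 'e) ultragraph"
    and M :: "'x measure"
    and R :: "'e \<Rightarrow> 'x set" and D :: "'v set \<Rightarrow> 'x set" and f g :: "'e \<Rightarrow> 'x \<Rightarrow> 'x"
    and F :: "'x \<Rightarrow> 'x"
    and A :: "'a cstar" and s :: "'e \<Rightarrow> 'a" and p :: "'v set \<Rightarrow> 'a"
    and \<pi> :: "'a \<Rightarrow> ('x \<Rightarrow> complex) \<Rightarrow> ('x \<Rightarrow> complex)"
    and P :: "('x \<Rightarrow> complex) \<Rightarrow> ('x \<Rightarrow> complex)"
  assumes "ultragraph G"
    and "sigma_finite_measure M"
    and "L2_separable M" and "L2_infinite_dimensional M"
    and "branching_system G M R D f g"
    and "nonsingular M F"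
    and "\<forall>e\<in>edges G. AE x in M. x \<in> R e \<longrightarrow> F x = g e x"
    and "universal_cstar_algebra G A s p"
    and "induced_representation G A s p M R D f g \<pi>"
    and "perron_frobenius M F P"
  shows "(\<forall>\<phi>\<in>L2 M. \<forall>n. \<forall>e :: nat \<Rightarrow> 'e.
           e ` {1..n} \<subseteq> edges G \<and> inj_on e {1..n} \<and> supported_in M \<phi> (\<Union>i\<in>{1..n}. R (e i)) \<longrightarrow>
           (AE x in M. P (\<lambda>y. (\<phi> y)\<^sup>2) x = (\<Sum>i=1..n. (\<pi> (star A (s (e i))) \<phi> x)\<^sup>2))) \<and>
         (\<forall>\<phi>\<in>L2 M. \<forall>e :: nat \<Rightarrow> 'e.
           e ` {1..} \<subseteq> edges G \<and> inj_on e {1..} \<and> supported_in M \<phi> (\<Union>i\<in>{1..}. R (e i)) \<longrightarrow>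
           L1_tendsto M (\<lambda>n x. \<Sum>i=1..n. (\<pi> (star A (s (e i))) \<phi> x)\<^sup>2) (P (\<lambda>y. (\<phi> y)\<^sup>2))) \<and>
         (\<forall>\<eta>\<in>L1 M. \<forall>\<eta>\<^sub>1 \<eta>\<^sub>2 \<eta>\<^sub>3 \<eta>\<^sub>4 :: 'x \<Rightarrow> real. \<forall>e :: nat \<Rightarrow> 'e.
           e ` {1..} \<subseteq> edges G \<and> inj_on e {1..} \<and>
           (\<forall>\<xi>\<in>{\<eta>\<^sub>1, \<eta>\<^sub>2, \<eta>\<^sub>3, \<eta>\<^sub>4}. integrable M \<xi> \<and> (AE x in M. 0 \<le> \<xi> x) \<and>
              supported_in M \<xi> (\<Union>i\<in>{1..}. R (e i))) \<and>
           (AE x in M. \<eta> x = complex_of_real (\<eta>\<^sub>1 x - \<eta>\<^sub>2 x) + \<i> * complex_of_real (\<eta>\<^sub>3 x - \<eta>\<^sub>4 x)) \<longrightarrow>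
           L1_tendsto M
             (\<lambda>n x. \<Sum>i=1..n.
                (\<pi> (star A (s (e i))) (\<lambda>y. complex_of_real (sqrt (\<eta>\<^sub>1 y))) x)\<^sup>2
              - (\<pi> (star A (s (e i))) (\<lambda>y. complex_of_real (sqrt (\<eta>\<^sub>2 y))) x)\<^sup>2
              + \<i> * (\<pi> (star A (s (e i))) (\<lambda>y. complex_of_real (sqrt (\<eta>\<^sub>3 y))) x)\<^sup>2
              - \<i> * (\<pi> (star A (s (e i))) (\<lambda>y. complex_of_real (sqrt (\<eta>\<^sub>4 y))) x)\<^sup>2)
             (P \<eta>))"
proof -
  interpret branching_system G M R D f g
    by fact
  have A: "cstar_algebra A" and ck: "cuntz_krieger_family G A s p"
    using \<open>universal_cstar_algebra G A s p\<close> by (auto simp: universal_cstar_algebra_def)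
  have F: "F \<in> measurable M M"
    using \<open>nonsingular M F\<close> by (simp add: nonsingular_def)
  note setting = A ck \<open>induced_representation G A s p M R D f g \<pi>\<close> F
    \<open>\<forall>e\<in>edges G. AE x in M. x \<in> R e \<longrightarrow> F x = g e x\<close> \<open>perron_frobenius M F P\<close>
  have P: "bounded_operator M (L1 M) (L1_norm M) P"
    using \<open>perron_frobenius M F P\<close> by (simp add: perron_frobenius_def)
  show ?thesis
  proof (intro conjI ballI allI impI; (elim conjE)?)
    fix \<phi> n and e :: "nat \<Rightarrow> 'e"
    assume "\<phi> \<in> L2 M" "e ` {1..n} \<subseteq> edges G" "inj_on e {1..n}"
      "supported_in M \<phi> (\<Union>i\<in>{1..n}. R (e i))"
    then show "AE x in M. P (\<lambda>y. (\<phi> y)\<^sup>2) x = (\<Sum>i=1..n. (\<pi> (star A (s (e i))) \<phi> x)\<^sup>2)"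
      by (intro perron_frobenius_finite[OF _ _ _ _ _ setting]) auto
  next
    fix \<phi> and e :: "nat \<Rightarrow> 'e"
    assume "\<phi> \<in> L2 M" "e ` {1..} \<subseteq> edges G" "inj_on e {1..}"
      "supported_in M \<phi> (\<Union>i\<in>{1..}. R (e i))"
    then show "L1_tendsto M (\<lambda>n x. \<Sum>i=1..n. (\<pi> (star A (s (e i))) \<phi> x)\<^sup>2) (P (\<lambda>y. (\<phi> y)\<^sup>2))"
      by (intro perron_frobenius_sequence[OF _ _ _ _ setting])
  next
    fix \<eta> and \<eta>\<^sub>1 \<eta>\<^sub>2 \<eta>\<^sub>3 \<eta>\<^sub>4 :: "'x \<Rightarrow> real" and e :: "nat \<Rightarrow> 'e"
    assume \<eta>: "\<eta> \<in> L1 M" and e: "e ` {1..} \<subseteq> edges G" "inj_on e {1..}"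
      and parts: "\<forall>\<xi>\<in>{\<eta>\<^sub>1, \<eta>\<^sub>2, \<eta>\<^sub>3, \<eta>\<^sub>4}. integrable M \<xi> \<and> (AE x in M. 0 \<le> \<xi> x) \<and>
        supported_in M \<xi> (\<Union>i\<in>{1..}. R (e i))"
      and \<eta>_eq: "AE x in M. \<eta> x = complex_of_real (\<eta>\<^sub>1 x - \<eta>\<^sub>2 x) + \<i> * complex_of_real (\<eta>\<^sub>3 x - \<eta>\<^sub>4 x)"
    let ?r = "\<lambda>\<xi> y. complex_of_real (sqrt (\<xi> y))"
    let ?sum = "\<lambda>\<xi> n x. \<Sum>i=1..n. (\<pi> (star A (s (e i))) (?r \<xi>) x)\<^sup>2"
    \<comment> \<open>The sequence case is applied to the square root of each of the four parts,
      which inherits the support because the root of 0 is 0.\<close>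
    have r: "?r \<xi> \<in> L2 M" "AE x in M. (?r \<xi> x)\<^sup>2 = complex_of_real (\<xi> x)"
        "L1_tendsto M (?sum \<xi>) (P (\<lambda>y. (?r \<xi> y)\<^sup>2))"
      if "\<xi> \<in> {\<eta>\<^sub>1, \<eta>\<^sub>2, \<eta>\<^sub>3, \<eta>\<^sub>4}" for \<xi>
    proof -
      have \<xi>: "integrable M \<xi>" "AE x in M. 0 \<le> \<xi> x" "supported_in M \<xi> (\<Union>i\<in>{1..}. R (e i))"
        using parts that by blast+
      show L2: "?r \<xi> \<in> L2 M"
        by (rule L2_sqrt[OF \<xi>(1)])
      show "AE x in M. (?r \<xi> x)\<^sup>2 = complex_of_real (\<xi> x)"
        \<comment> \<open>The root squares back to \<xi> where \<xi> is nonnegative, hence almost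
          everywhere.\<close>
        using \<xi>(2) by eventually_elim (simp flip: of_real_power)
      have "supported_in M (?r \<xi>) (\<Union>i\<in>{1..}. R (e i))"
        using \<xi>(3) unfolding supported_in_def by eventually_elim simp
      then show "L1_tendsto M (?sum \<xi>) (P (\<lambda>y. (?r \<xi> y)\<^sup>2))"
        by (rule perron_frobenius_sequence[OF e L2 _ setting])
    qed
    let ?q = "\<lambda>\<xi> y. (?r \<xi> y)\<^sup>2"
    have "AE x in M. \<eta> x = ?q \<eta>\<^sub>1 x + ((- 1) * ?q \<eta>\<^sub>2 x + (\<i> * ?q \<eta>\<^sub>3 x + (- \<i>) * ?q \<eta>\<^sub>4 x))"
    proof -
      have "AE x in M. ?q \<eta>\<^sub>1 x = complex_of_real (\<eta>\<^sub>1 x)" "AE x in M. ?q \<eta>\<^sub>2 x = complex_of_real (\<eta>\<^sub>2 x)"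
        "AE x in M. ?q \<eta>\<^sub>3 x = complex_of_real (\<eta>\<^sub>3 x)" "AE x in M. ?q \<eta>\<^sub>4 x = complex_of_real (\<eta>\<^sub>4 x)"
        by (rule r(2); simp)+
      then show ?thesis
        using \<eta>_eq by eventually_elim (simp add: algebra_simps)
    qed
    then have "AE x in M. P \<eta> x = P (?q \<eta>\<^sub>1) x +
        ((- 1) * P (?q \<eta>\<^sub>2) x + (\<i> * P (?q \<eta>\<^sub>3) x + (- \<i>) * P (?q \<eta>\<^sub>4) x))"
      by (intro bounded_operator_L1_combination[OF P \<eta>] L2_power2 r) simp_all
    \<comment> \<open>The equation is turned around so that it replaces the limit found below by the
      representative \<open>P \<eta>\<close>.\<close>
    then have P_eq: "AE x in M. P (?q \<eta>\<^sub>1) x +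
        ((- 1) * P (?q \<eta>\<^sub>2) x + (\<i> * P (?q \<eta>\<^sub>3) x + (- \<i>) * P (?q \<eta>\<^sub>4) x)) = P \<eta> x"
      by eventually_elim simp
    have lim: "L1_tendsto M
        (\<lambda>n x. ?sum \<eta>\<^sub>1 n x + ((- 1) * ?sum \<eta>\<^sub>2 n x + (\<i> * ?sum \<eta>\<^sub>3 n x + (- \<i>) * ?sum \<eta>\<^sub>4 n x)))
        (\<lambda>x. P (?q \<eta>\<^sub>1) x + ((- 1) * P (?q \<eta>\<^sub>2) x + (\<i> * P (?q \<eta>\<^sub>3) x + (- \<i>) * P (?q \<eta>\<^sub>4) x)))"
      by (intro L1_tendsto_add L1_tendsto_cmult r(3)) simp_all
    \<comment> \<open>Regrouping four finite sums into one is an exact pointwise identity for every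
      \<open>n\<close>, so no limit is interchanged.\<close>
    have sums: "(\<lambda>n x. ?sum \<eta>\<^sub>1 n x + ((- 1) * ?sum \<eta>\<^sub>2 n x + (\<i> * ?sum \<eta>\<^sub>3 n x + (- \<i>) * ?sum \<eta>\<^sub>4 n x)))
        = (\<lambda>n x. \<Sum>i=1..n. (\<pi> (star A (s (e i))) (?r \<eta>\<^sub>1) x)\<^sup>2 - (\<pi> (star A (s (e i))) (?r \<eta>\<^sub>2) x)\<^sup>2
          + \<i> * (\<pi> (star A (s (e i))) (?r \<eta>\<^sub>3) x)\<^sup>2 - \<i> * (\<pi> (star A (s (e i))) (?r \<eta>\<^sub>4) x)\<^sup>2)"
      by (simp add: sum.distrib sum_subtractf sum_distrib_left sum_negf algebra_simps)
    have "P \<eta> \<in> borel_measurable M"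
      by (rule L1_measurable[OF bounded_operator_L1_closed[OF P \<eta>]])
    then have "L1_tendsto M
        (\<lambda>n x. ?sum \<eta>\<^sub>1 n x + ((- 1) * ?sum \<eta>\<^sub>2 n x + (\<i> * ?sum \<eta>\<^sub>3 n x + (- \<i>) * ?sum \<eta>\<^sub>4 n x))) (P \<eta>)"
      using lim by (intro L1_tendsto_cong_AE[OF lim _ _ _ P_eq])
        (auto simp: L1_tendsto_def intro: L1_measurable)
    then show "L1_tendsto M
        (\<lambda>n x. \<Sum>i=1..n. (\<pi> (star A (s (e i))) (?r \<eta>\<^sub>1) x)\<^sup>2 - (\<pi> (star A (s (e i))) (?r \<eta>\<^sub>2) x)\<^sup>2
          + \<i> * (\<pi> (star A (s (e i))) (?r \<eta>\<^sub>3) x)\<^sup>2 - \<i> * (\<pi> (star A (s (e i))) (?r \<eta>\<^sub>4) x)\<^sup>2) (P \<eta>)"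
      unfolding sums .
  qed
qed

end
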